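(* Let $C=150$ and let $\alpha=\alpha(n)$ satisfy $C\le\alpha\le\frac{n}{\ln n}$. Let $p=\alpha\frac{\ln n}{n}$ and $G\sim G(n,p)$. Then with high probability all of the following hold: (P1) $G$ is connected; (P2) for every $v\in[n]$, $|d(v)-\alpha\ln n|\le 2\sqrt{\alpha}\ln n$; in particular $\frac{5\alpha}{6}\ln n\le d(v)\le\frac{4\alpha}{3}\ln n$; (P3) for every non-empty $S\subseteq[n]$ with $|S|\le 0.8n$, $|\partial S|>\frac{|S||S^c|\alpha\ln n}{2n}$; (P4) for every large enough constant $K>0$ (not depending on $\alpha$) and every non-empty $A\subseteq[n]$ with $|A|=a$: if $\frac{n}{\alpha\ln n}\le a\le\frac{n}{\ln n}$ then $\left|E\big(A,\{u\in N(A): |E(u,A)|\ge Ka\alpha\ln n/n\}\big)\right|\le a\alpha\ln n/K$; and if $a<\frac{n}{\alpha\ln n}$ then $\left|E\big(A,\{u\in N(A): |E(u,A)|\ge K\}\big)\right|\le a\alpha\ln n/\ln K$; (P5) for every $A\subseteq[n]$ with $|A|=n(\ln\ln n)^{1.5}/\ln n$, there are at most $|A|/2$ vertices $v\notin A$ with $|E(v,A)|\le \alpha(\ln\ln n)^{1.5}/2$; (P6) if $\alpha<\ln^2 n$, then for every $v\in[n]$, every integer $0\le r\le\frac{\ln n}{15\ln\ln n}$ and every $w\in N(v,r)$, we have $|E(w,B(v,r))|\le 5$.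
   Context: $G(n,p)$ is the Erdős–Rényi random graph on $[n]$. For $A,B\subseteq[n]$, $E(A,B)$ is the set of edges with one endpoint in $A$ and the other in $B$ (with $E(v,B)=E(\{v\},B)$). $N(A)$ is the external neighbourhood of $A$ (vertices outside $A$ with a neighbour in $A$). $d(v)$ is the degree of $v$. $\partial S$ is the set of edges with exactly one endpoint in $S$, and $S^c=[n]\setminus S$. $B(v,r)$ is the set of vertices at graph distance at most $r$ from $v$, and $N(v,r)=B(v,r)\setminus B(v,r-1)$. "With high probability" means with probability tending to $1$ as $n\to\infty$. *)

theory Defs
  imports "HOL-Probability.Probability" "HOL-Library.Extended_Nat"
begin

text \<open>
  A simple graph on a vertex set \<open>V\<close> is represented by its edge set, a subset of \<open>all_edges V\<close>.
\<close>

definition all_edges :: "'a set \<Rightarrow> 'a set set" where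
  "all_edges V = {e. e \<subseteq> V \<and> card e = 2}"

text \<open>
  The random graph \<open>G(n,p)\<close> on \<open>{1..n}\<close>, as a distribution on edge sets. Note that
  \<^const>\<open>bernoulli_pmf\<close> truncates its parameter to \<open>[0,1]\<close>.
\<close>

definition gnp :: "nat \<Rightarrow> real \<Rightarrow> nat set set pmf" where
  "gnp n p = map_pmf (\<lambda>f. {e \<in> all_edges {1..n}. f e})
     (Pi_pmf (all_edges {1..n}) False (\<lambda>_. bernoulli_pmf p))"

definition edges_between :: "'a set set \<Rightarrow> 'a set \<Rightarrow> 'a set \<Rightarrow> 'a set set" where
  "edges_between E A B = {e \<in> E. \<exists>x\<in>A. \<exists>y\<in>B. e = {x, y}}"

definition ext_nbhd :: "'a set \<Rightarrow> 'a set set \<Rightarrow> 'a set \<Rightarrow> 'a set" where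
  "ext_nbhd V E A = {v \<in> V - A. \<exists>u\<in>A. {u, v} \<in> E}"

definition deg :: "'a set set \<Rightarrow> 'a \<Rightarrow> nat" where
  "deg E v = card {e \<in> E. v \<in> e}"

definition edge_boundary :: "'a set set \<Rightarrow> 'a set \<Rightarrow> 'a set set" where
  "edge_boundary E S = {e \<in> E. card (e \<inter> S) = 1}"

definition adj :: "'a set set \<Rightarrow> ('a \<times> 'a) set" where
  "adj E = {(u, v). {u, v} \<in> E}"

definition graph_connected :: "'a set \<Rightarrow> 'a set set \<Rightarrow> bool" where
  "graph_connected V E \<longleftrightarrow> V \<noteq> {} \<and> (\<forall>u\<in>V. \<forall>v\<in>V. (u, v) \<in> (adj E)\<^sup>*)"

text \<open>Length of a shortest walk; the infimum is \<open>\<infinity>\<close> if there is none.\<close>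

definition graph_dist :: "'a set set \<Rightarrow> 'a \<Rightarrow> 'a \<Rightarrow> enat" where
  "graph_dist E u v = Inf {enat k | k. (u, v) \<in> adj E ^^ k}"

definition graph_ball :: "'a set \<Rightarrow> 'a set set \<Rightarrow> 'a \<Rightarrow> nat \<Rightarrow> 'a set" where
  "graph_ball V E v r = {w \<in> V. graph_dist E v w \<le> enat r}"

text \<open>
  \<open>N(v,r) = B(v,r) - B(v,r-1)\<close>; the case \<open>r = 0\<close>, where \<open>B(v,-1)\<close> is empty, is separated
  because subtraction on \<^typ>\<open>nat\<close> truncates.
\<close>

definition graph_sphere :: "'a set \<Rightarrow> 'a set set \<Rightarrow> 'a \<Rightarrow> nat \<Rightarrow> 'a set" where
  "graph_sphere V E v r =
     graph_ball V E v r - (if r = 0 then {} else graph_ball V E v (r - 1))"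

end

theory Submission
  imports Defs "HOL-Real_Asymp.Real_Asymp"
begin

text \<open>
  Every property fails with probability tending to \<open>0\<close> by a union bound over witnesses of its
  failure. All witnesses except those for (P6) are pairs of disjoint vertex sets \<open>A, B\<close> with an
  atypical number of edges between them, which is controlled by a Chernoff bound; the union bounds
  are summed through \<open>(\<Sum>S\<subseteq>V. x^|S|) = (1 + x)^|V|\<close>, so that no binomial coefficient has to be
  estimated. In (P4) the witness for \<open>A\<close> is its set \<open>U\<close> of heavy neighbours, which satisfies both
  \<open>|E(A,U)| > m\<close> and \<open>|E(A,U)| \<ge> T|U|\<close>; the Chernoff bound is applied to a weighted sum of these two
  inequalities, where the second one makes the sum over \<open>U\<close> converge. In (P5) the witness is the whole
  set of light vertices. (P1) follows from (P3).

  If (P6) fails, then \<open>w\<close> has six neighbours in a tree that contains \<open>v\<close>, avoids \<open>w\<close> and has \<open>k \<le> 6r\<close>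
  edges. There are at most \<open>k! n^k\<close> such trees from a given \<open>v\<close>, and each of these
  configurations has \<open>k + 2\<close> vertices and \<open>k + 6\<close> edges.
\<close>

subsection \<open>Edge counts in the random graph\<close>

lemma finite_all_edges [simp]: "finite V \<Longrightarrow> finite (all_edges V)"
  unfolding all_edges_def by (rule finite_subset[of _ "Pow V"]) auto

lemma set_pmf_gnp: "E \<in> set_pmf (gnp n p) \<Longrightarrow> E \<subseteq> all_edges {1..n}"
  unfolding gnp_def by auto

text \<open>Independence makes the expectation factor over the potential edges, and those outside
  \<open>F\<close> contribute 1. The weights are left open: \<open>1, 0\<close> gives the
  probability that all of \<open>F\<close> is present, \<open>exp \<theta>, 1\<close> the moment
  generating function of \<open>card (E \<inter> F)\<close>.\<close>

lemma gnp_expectation_prod: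
  fixes x y :: real
  assumes p: "0 \<le> p" "p \<le> 1" and xy: "0 \<le> x" "0 \<le> y" and F: "F \<subseteq> all_edges {1..n}"
  shows "measure_pmf.expectation (gnp n p) (\<lambda>E. \<Prod>e\<in>F. if e \<in> E then x else y) =
           (p * x + (1 - p) * y) ^ card F"
proof -
  let ?A = "all_edges {1..n}"
  let ?g = "\<lambda>e b. if e \<in> F then (if b then x else y) else 1 :: real"
  have "measure_pmf.expectation (gnp n p) (\<lambda>E. \<Prod>e\<in>F. if e \<in> E then x else y) =
      measure_pmf.expectation (Pi_pmf ?A False (\<lambda>_. bernoulli_pmf p))
        (\<lambda>f. \<Prod>e\<in>?A. ?g e (f e))"
    unfolding gnp_def integral_map_pmf
  proof (rule arg_cong[where f = "lebesgue_integral _"], rule ext)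
    fix f
    have "(\<Prod>e\<in>F. if e \<in> {e \<in> ?A. f e} then x else y) = (\<Prod>e\<in>F. ?g e (f e))"
      using F by (intro prod.cong) auto
    also have "\<dots> = (\<Prod>e\<in>?A. ?g e (f e))"
      using F by (intro prod.mono_neutral_left) auto
    finally show "(\<Prod>e\<in>F. if e \<in> {e \<in> ?A. f e} then x else y) = (\<Prod>e\<in>?A. ?g e (f e))" .
  qed
  also have "\<dots> = (\<Prod>e\<in>?A. measure_pmf.expectation (bernoulli_pmf p) (?g e))"
    using xy by (subst expectation_prod_Pi_pmf) (auto intro: integrable_measure_pmf_finite)
  also have "\<dots> = (\<Prod>e\<in>?A. if e \<in> F then p * x + (1 - p) * y else 1)"
    using p by (intro prod.cong refl) (auto simp: algebra_simps)
  also have "\<dots> = (\<Prod>e\<in>F. p * x + (1 - p) * y)"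
    using F by (intro prod.mono_neutral_cong_right) auto
  finally show ?thesis by simp
qed

lemma gnp_prob_superset:
  assumes p: "0 \<le> p" "p \<le> 1" and F: "F \<subseteq> all_edges {1..n}"
  shows "measure_pmf.prob (gnp n p) {E. F \<subseteq> E} = p ^ card F"
proof -
  have finF: "finite F"
    using F by (rule finite_subset) simp
  have "measure_pmf.prob (gnp n p) {E. F \<subseteq> E} =
      measure_pmf.expectation (gnp n p) (indicator {E. F \<subseteq> E})"
    by simp
  also have "(indicator {E. F \<subseteq> E} :: _ \<Rightarrow> real) = (\<lambda>E. \<Prod>e\<in>F. if e \<in> E then 1 else 0)"
    using finF by (auto simp: fun_eq_iff indicator_def prod_zero_iff intro!: prod.neutral)
  also have "measure_pmf.expectation (gnp n p) \<dots> = p ^ card F"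
    using gnp_expectation_prod[OF p _ _ F, of 1 0] by simp
  finally show ?thesis .
qed

text \<open>Markov's inequality for the exponential moment, with \<open>1 + u \<le> exp u\<close>
  applied to each factor. Since \<open>\<theta>\<close> may have either sign and multiplies the
  count inside the event, this one bound serves both tails.\<close>

lemma gnp_chernoff:
  fixes \<theta> :: real
  assumes p: "0 \<le> p" "p \<le> 1" and F: "F \<subseteq> all_edges {1..n}"
  shows "measure_pmf.prob (gnp n p) {E. t \<le> \<theta> * real (card (E \<inter> F))}
           \<le> exp (real (card F) * p * (exp \<theta> - 1) - t)"
proof -
  let ?M = "gnp n p"
  have finF: "finite F"
    using F by (rule finite_subset) simp
  have eq: "(\<Prod>e\<in>F. if e \<in> E then exp \<theta> else 1) = exp (\<theta> * real (card (E \<inter> F)))" for E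
    using finF by (simp add: prod.If_cases exp_of_nat2_mult Int_commute Collect_mem_eq)
  have "set_pmf ?M \<subseteq> Pow (all_edges {1..n})"
    using set_pmf_gnp by blast
  then have fin: "finite (set_pmf ?M)"
    by (rule finite_subset) simp
  have "measure_pmf.prob ?M {E. t \<le> \<theta> * real (card (E \<inter> F))} =
      measure_pmf.prob ?M {E \<in> space ?M. exp t \<le> exp (\<theta> * real (card (E \<inter> F)))}"
    by simp
  also have "\<dots> \<le> measure_pmf.expectation ?M (\<lambda>E. exp (\<theta> * real (card (E \<inter> F)))) / exp t"
    by (intro integral_Markov_inequality_measure integrable_measure_pmf_finite fin) auto
  also have "\<dots> = (1 + p * (exp \<theta> - 1)) ^ card F / exp t"
    unfolding eq[symmetric] by (subst gnp_expectation_prod[OF p _ _ F]) (auto simp: algebra_simps)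
  also have "\<dots> \<le> exp (p * (exp \<theta> - 1)) ^ card F / exp t"
  proof (intro divide_right_mono power_mono)
    have "0 \<le> p * exp \<theta> + (1 - p)"
      using p by simp
    then show "0 \<le> 1 + p * (exp \<theta> - 1)"
      by (simp add: algebra_simps)
  qed auto
  also have "\<dots> = exp (real (card F) * p * (exp \<theta> - 1) - t)"
    by (simp add: exp_diff exp_of_nat_mult[symmetric] mult.assoc)
  finally show ?thesis .
qed

text \<open>A witness has to be found only for \<open>E\<close> in the support, which for
  \<open>gnp\<close> supplies \<open>E \<subseteq> all_edges {1..n}\<close>.\<close>

lemma prob_union_bound:
  fixes M :: "'a pmf"
  assumes "finite I"
    and "\<And>E. E \<in> set_pmf M \<Longrightarrow> P E \<Longrightarrow> \<exists>i\<in>I. Q i E"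
    and "\<And>i. i \<in> I \<Longrightarrow> measure_pmf.prob M {E. Q i E} \<le> b i"
  shows "measure_pmf.prob M {E. P E} \<le> (\<Sum>i\<in>I. b i)"
proof -
  have "measure_pmf.prob M {E. P E} \<le> measure_pmf.prob M (\<Union>i\<in>I. {E. Q i E})"
    using assms(2) by (intro measure_pmf.finite_measure_mono_AE AE_pmfI) auto
  also have "\<dots> \<le> (\<Sum>i\<in>I. measure_pmf.prob M {E. Q i E})"
    using assms(1) by (intro measure_pmf.finite_measure_subadditive_finite) auto
  also have "\<dots> \<le> (\<Sum>i\<in>I. b i)"
    by (intro sum_mono assms(3))
  finally show ?thesis .
qed

section \<open>Sums over all subsets of a finite set\<close>

lemma sum_Pow_power_card:
  fixes x :: "'b :: comm_semiring_1"
  assumes "finite V"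
  shows "(\<Sum>S\<in>Pow V. x ^ card S) = (1 + x) ^ card V"
  using assms
proof (induction V rule: finite_induct)
  case (insert a V)
  have "(\<Sum>S\<in>Pow (insert a V). x ^ card S) =
      (\<Sum>S\<in>Pow V. x ^ card S) + (\<Sum>S\<in>insert a ` Pow V. x ^ card S)"
    using insert.hyps unfolding Pow_insert by (intro sum.union_disjoint) auto
  also have "(\<Sum>S\<in>insert a ` Pow V. x ^ card S) = (\<Sum>S\<in>Pow V. x ^ card (insert a S))"
    using insert.hyps by (subst sum.reindex) (auto simp: inj_on_def)
  also have "\<dots> = (\<Sum>S\<in>Pow V. x * x ^ card S)"
    using insert.hyps
    by (intro sum.cong refl) (auto simp: card_insert_if finite_subset)
  finally show ?case
    using insert by (simp add: sum_distrib_left[symmetric] algebra_simps)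
qed simp

lemma sum_Pow_power_card_le:
  fixes x :: real
  assumes "finite V" "0 \<le> x"
  shows "(\<Sum>S\<in>Pow V. x ^ card S) \<le> exp (real (card V) * x)"
proof -
  have "(1 + x) ^ card V \<le> exp x ^ card V"
    using assms by (intro power_mono) auto
  then show ?thesis
    using assms by (simp add: sum_Pow_power_card exp_of_nat_mult)
qed

text \<open>The pairs that could be edges between \<open>A\<close> and \<open>B\<close>: a set that
  does not depend on the random graph, as the Chernoff bound requires.\<close>

definition cross_edges :: "'a set \<Rightarrow> 'a set \<Rightarrow> 'a set set" where
  "cross_edges A B = (\<lambda>(x, y). {x, y}) ` (A \<times> B)"

text \<open>Disjointness makes the map from ordered pairs to two-element sets injective.\<close>

lemma card_cross_edges:
  assumes "A \<inter> B = {}"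
  shows "card (cross_edges A B) = card A * card B"
  unfolding cross_edges_def using assms
  by (subst card_image) (auto simp: inj_on_def doubleton_eq_iff card_cartesian_product)

lemma cross_edges_subset:
  assumes "A \<subseteq> V" "B \<subseteq> V" "A \<inter> B = {}"
  shows "cross_edges A B \<subseteq> all_edges V"
  using assms unfolding cross_edges_def all_edges_def by (auto simp: card_insert_if)

lemma edges_between_eq_cross: "edges_between E A B = E \<inter> cross_edges A B"
  unfolding edges_between_def cross_edges_def by auto

section \<open>Boundaries, degrees and edge counts through cross edges\<close>

lemma edge_boundary_eq_cross:
  assumes "E \<subseteq> all_edges V" "S \<subseteq> V"
  shows "edge_boundary E S = E \<inter> cross_edges S (V - S)"
proof -
  have "card (e \<inter> S) = 1 \<longleftrightarrow> e \<in> cross_edges S (V - S)" if "e \<in> E" for e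
  proof -
    from that assms obtain x y where e: "e = {x, y}" "x \<noteq> y" "x \<in> V" "y \<in> V"
      unfolding all_edges_def by (auto simp: card_2_iff)
    show ?thesis
      unfolding e cross_edges_def using e(2-4)
      by (cases "x \<in> S"; cases "y \<in> S") (auto simp: image_iff doubleton_eq_iff Int_insert_left)
  qed
  then show ?thesis unfolding edge_boundary_def by auto
qed

lemma deg_eq_cross:
  assumes "E \<subseteq> all_edges V" "v \<in> V"
  shows "deg E v = card (E \<inter> cross_edges {v} (V - {v}))"
proof -
  have "v \<in> e \<longleftrightarrow> e \<in> cross_edges {v} (V - {v})" if "e \<in> E" for e
  proof -
    from that assms obtain x y where e: "e = {x, y}" "x \<noteq> y" "x \<in> V" "y \<in> V"
      unfolding all_edges_def by (auto simp: card_2_iff)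
    show ?thesis
      unfolding e cross_edges_def using e(2-4)
      by (auto simp: image_iff doubleton_eq_iff)
  qed
  then show ?thesis unfolding deg_def by (intro arg_cong[where f = card]) auto
qed

text \<open>Each edge between the disjoint sets has exactly one endpoint in \<open>U\<close>. This
  turns a bound for every vertex of \<open>U\<close> into a bound on all edges between
  \<open>A\<close> and \<open>U\<close>.\<close>

lemma card_cross_edges_sum:
  assumes "finite A" "finite U" "A \<inter> U = {}"
  shows "card (E \<inter> cross_edges A U) = (\<Sum>u\<in>U. card (E \<inter> cross_edges {u} A))"
proof -
  have "E \<inter> cross_edges A U = (\<Union>u\<in>U. E \<inter> cross_edges {u} A)"
    unfolding cross_edges_def by (auto simp: insert_commute image_iff)
  moreover have "card (\<Union>u\<in>U. E \<inter> cross_edges {u} A) =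
      (\<Sum>u\<in>U. card (E \<inter> cross_edges {u} A))"
    using assms by (intro card_UN_disjoint) (auto simp: cross_edges_def doubleton_eq_iff)
  ultimately show ?thesis by simp
qed

section \<open>Numerical bounds on the exponential function\<close>

lemma exp_minus_half_le: "exp (- 1 / 2 :: real) \<le> 31 / 50"
proof -
  have "50 / 31 \<le> exp (1 / 2 :: real)"
    using exp_lower_Taylor_quadratic[of "1 / 2 :: real"] by (simp add: power2_eq_square)
  then show ?thesis by (simp add: exp_minus field_simps)
qed

text \<open>Applying \<open>exp_bound\<close> to \<open>x / 2\<close> and squaring brings the
  coefficient of x^2 from 1 down to 4/5. The degree estimate relies on a value below 1: with
  coefficient c its tail is of order n^(-1/c), which must beat a union over n vertices.\<close>

lemma exp_le_quadratic_pos: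
  fixes x :: real
  assumes "0 \<le> x" "x \<le> 3 / 25"
  shows "exp x \<le> 1 + x + 4 / 5 * x\<^sup>2"
proof -
  have "exp (x / 2) \<le> 1 + x / 2 + (x / 2)\<^sup>2"
    using assms by (intro exp_bound) auto
  then have "exp (x / 2) ^ 2 \<le> (1 + x / 2 + (x / 2)\<^sup>2) ^ 2"
    by (intro power_mono) auto
  moreover have "exp (x / 2) ^ 2 = exp x"
    by (simp add: exp_of_nat_mult[symmetric])
  moreover have "(1 + x / 2 + (x / 2)\<^sup>2) ^ 2 = 1 + x + x\<^sup>2 * (3 / 4 + x / 4 + x\<^sup>2 / 16)"
    by (simp add: power2_eq_square algebra_simps)
  moreover have "x\<^sup>2 * (3 / 4 + x / 4 + x\<^sup>2 / 16) \<le> x\<^sup>2 * (4 / 5)"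
    using assms mult_mono[of x "3/25" x "3/25"]
    by (intro mult_left_mono) (auto simp: power2_eq_square)
  ultimately show ?thesis by linarith
qed

text \<open>The product of the right-hand side with \<open>1 + x + x^2 / 2\<close>, a lower bound
  for \<open>exp x\<close>, is at least 1.\<close>

lemma exp_le_quadratic_neg:
  fixes x :: real
  assumes "0 \<le> x" "x \<le> 3 / 25"
  shows "exp (- x) \<le> 1 - x + 4 / 5 * x\<^sup>2"
proof -
  have "1 \<le> (1 - x + 4 / 5 * x\<^sup>2) * (1 + x + x\<^sup>2 / 2)"
  proof -
    have "(1 - x + 4 / 5 * x\<^sup>2) * (1 + x + x\<^sup>2 / 2) = 1 + x\<^sup>2 * (3/10 + x * (3/10) + x\<^sup>2 * (2/5))"
      by (simp add: power2_eq_square algebra_simps)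
    then show ?thesis using assms by simp
  qed
  also have "\<dots> \<le> (1 - x + 4 / 5 * x\<^sup>2) * exp x"
    using assms by (intro mult_left_mono exp_lower_Taylor_quadratic) auto
  finally show ?thesis by (simp add: exp_minus field_simps)
qed

subsection \<open>Boundaries, connectivity and degrees\<close>

text \<open>The predicates from here to \<open>sparse_balls\<close> repeat clauses of the theorem,
  so that unfolding them yields its statement.\<close>

definition degrees_concentrated :: "nat \<Rightarrow> real \<Rightarrow> nat set set \<Rightarrow> bool" where
  "degrees_concentrated n \<alpha> E \<longleftrightarrow>
     (\<forall>v\<in>{1..n}.
        \<bar>real (deg E v) - \<alpha> * ln (real n)\<bar> \<le> 2 * sqrt \<alpha> * ln (real n) \<and>
        5 * \<alpha> / 6 * ln (real n) \<le> real (deg E v) \<and>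
        real (deg E v) \<le> 4 * \<alpha> / 3 * ln (real n))"

definition large_boundaries :: "nat \<Rightarrow> real \<Rightarrow> nat set set \<Rightarrow> bool" where
  "large_boundaries n \<alpha> E \<longleftrightarrow>
     (\<forall>S \<subseteq> {1..n}. S \<noteq> {} \<and> real (card S) \<le> 0.8 * real n \<longrightarrow>
        real (card (edge_boundary E S)) >
          real (card S) * real (card ({1..n} - S)) * \<alpha> * ln (real n) / (2 * real n))"

definition heavy_neighbours :: "nat \<Rightarrow> nat set set \<Rightarrow> nat set \<Rightarrow> real \<Rightarrow> nat set" where
  "heavy_neighbours n E A T = {u \<in> ext_nbhd {1..n} E A. real (card (edges_between E {u} A)) \<ge> T}"

definition few_heavy_edges :: "nat \<Rightarrow> real \<Rightarrow> real \<Rightarrow> nat set set \<Rightarrow> bool" where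
  "few_heavy_edges n \<alpha> K E \<longleftrightarrow>
     (\<forall>A \<subseteq> {1..n}. A \<noteq> {} \<longrightarrow>
        (real n / (\<alpha> * ln (real n)) \<le> real (card A) \<and> real (card A) \<le> real n / ln (real n) \<longrightarrow>
         real (card (edges_between E A
           (heavy_neighbours n E A (K * real (card A) * \<alpha> * ln (real n) / real n))))
           \<le> real (card A) * \<alpha> * ln (real n) / K) \<and>
        (real (card A) < real n / (\<alpha> * ln (real n)) \<longrightarrow>
         real (card (edges_between E A (heavy_neighbours n E A K)))
           \<le> real (card A) * \<alpha> * ln (real n) / ln K))"

text \<open>The prescribed size of \<open>A\<close> need not be an integer, so both roundings are
  covered.\<close>

definition few_light_vertices :: "nat \<Rightarrow> real \<Rightarrow> nat set set \<Rightarrow> bool" where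
  "few_light_vertices n \<alpha> E \<longleftrightarrow>
     (\<forall>A \<subseteq> {1..n}.
        card A \<in> {nat \<lfloor>real n * ln (ln (real n)) powr 1.5 / ln (real n)\<rfloor>,
                  nat \<lceil>real n * ln (ln (real n)) powr 1.5 / ln (real n)\<rceil>} \<longrightarrow>
        real (card {v \<in> {1..n} - A.
            real (card (edges_between E {v} A)) \<le> \<alpha> * ln (ln (real n)) powr 1.5 / 2})
          \<le> real (card A) / 2)"

definition sparse_balls :: "nat \<Rightarrow> nat set set \<Rightarrow> bool" where
  "sparse_balls n E \<longleftrightarrow>
     (\<forall>v\<in>{1..n}. \<forall>r::nat. real r \<le> ln (real n) / (15 * ln (ln (real n))) \<longrightarrow>
        (\<forall>w \<in> graph_sphere {1..n} E v r.
           card (edges_between E {w} (graph_ball {1..n} E v r)) \<le> 5))"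

text \<open>All estimates are made for one fixed n; limits are taken only at the end. The bound
  \<open>3 \<le> n\<close> gives \<open>1 \<le> L\<close>, and the bounds on \<alpha> place p in
  [0,1], so the truncation in \<open>bernoulli_pmf\<close> has no effect.\<close>

locale gnp_regime =
  fixes n :: nat and \<alpha> p :: real
  assumes n_ge: "3 \<le> n" and \<alpha>_ge: "150 \<le> \<alpha>" and \<alpha>_le: "\<alpha> \<le> real n / ln (real n)"
    and p_eq: "p = \<alpha> * ln (real n) / real n"
begin

abbreviation "L \<equiv> ln (real n)"
abbreviation "V \<equiv> {1..n}"
abbreviation "G \<equiv> gnp n p"

section \<open>Elementary relations between the parameters\<close>

lemma L_ge_1: "1 \<le> L"
proof -
  have "exp 1 \<le> (3 :: real)" using exp_le by simp
  also have "\<dots> \<le> real n" using n_ge by simp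
  finally show ?thesis using n_ge by (simp add: ln_ge_iff)
qed

lemma n_pos: "0 < real n"
  using n_ge by simp

lemma exp_L: "exp L = real n"
  using n_pos by simp

lemma d_ge: "150 * L \<le> \<alpha> * L"
  using \<alpha>_ge L_ge_1 by (intro mult_right_mono) auto

lemma p_pos: "0 < p"
  unfolding p_eq using \<alpha>_ge L_ge_1 n_ge by (intro divide_pos_pos mult_pos_pos) auto

lemma p_le_1: "p \<le> 1"
  using \<alpha>_le L_ge_1 n_ge by (simp add: p_eq field_simps)

lemma n_mult_p: "real n * p = \<alpha> * L"
  using n_ge by (simp add: p_eq)

lemma chernoff:
  assumes "F \<subseteq> all_edges V"
  shows "measure_pmf.prob G {E. t \<le> \<theta> * real (card (E \<inter> F))}
           \<le> exp (real (card F) * p * (exp \<theta> - 1) - t)"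
  using gnp_chernoff[OF less_imp_le[OF p_pos] p_le_1 assms] .

lemma real_card_compl:
  assumes "S \<subseteq> V"
  shows "real (card (V - S)) = real n - real (card S)"
proof -
  have "card S \<le> n"
    using card_mono[OF _ assms] by simp
  then show ?thesis
    using assms by (simp add: card_Diff_subset finite_subset of_nat_diff)
qed

text \<open>Here \<open>exp (- 3 * L)\<close> is n^(-3), so the sum over all subsets is at most
  exp(n^(-2)). The subtracted 1 is the term of the empty set; its removal makes the bound tend to
  0.\<close>

lemma sum_nonempty_subsets_le:
  assumes "I \<subseteq> Pow V - {{}}"
  shows "(\<Sum>S\<in>I. exp (- 3 * L) ^ card S) \<le> exp (real n powr - 2) - 1"
proof -
  have "(\<Sum>S\<in>I. exp (- 3 * L) ^ card S) \<le> (\<Sum>S\<in>Pow V - {{}}. exp (- 3 * L) ^ card S)"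
    using assms by (intro sum_mono2) auto
  also have "\<dots> = (\<Sum>S\<in>Pow V. exp (- 3 * L) ^ card S) - 1"
    by (subst sum_diff) auto
  also have "(\<Sum>S\<in>Pow V. exp (- 3 * L) ^ card S) \<le> exp (real (card V) * exp (- 3 * L))"
    by (intro sum_Pow_power_card_le) auto
  also have "real (card V) * exp (- 3 * L) = exp L * exp (- 3 * L)"
    using exp_L by simp
  also have "\<dots> = exp (- 2 * L)"
    by (simp only: exp_add[symmetric]) simp
  also have "\<dots> = real n powr - 2"
    using n_pos by (simp add: powr_def)
  finally show ?thesis by simp
qed

text \<open>With m(S) the expected boundary, the Chernoff bound at \<theta> = -1/2 has exponent at
  most (-0.38 + 0.25) m(S). The complement has at least n/5 vertices and np \<ge> 150 L, so m(S)
  \<ge> 30 L |S|, and each S fails with probability at most n^(-3|S|).\<close>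

lemma prob_not_large_boundaries:
  "measure_pmf.prob G {E. \<not> large_boundaries n \<alpha> E} \<le> exp (real n powr - 2) - 1"
proof -
  define m where "m S = real (card S) * real (card (V - S)) * p" for S
  let ?I = "{S \<in> Pow V. S \<noteq> {} \<and> real (card S) \<le> 0.8 * real n}"
  have "measure_pmf.prob G {E. \<not> large_boundaries n \<alpha> E} \<le> (\<Sum>S\<in>?I. exp (- 3 * L) ^ card S)"
  proof (rule prob_union_bound[where
        Q = "\<lambda>S E. - (m S / 4) \<le> - 1 / 2 * real (card (E \<inter> cross_edges S (V - S)))"])
    show "finite ?I" by simp
  next
    fix E assume "E \<in> set_pmf G" and bad: "\<not> large_boundaries n \<alpha> E"
    then have E: "E \<subseteq> all_edges V" by (intro set_pmf_gnp)
    have "m S / 2 = real (card S) * real (card (V - S)) * \<alpha> * L / (2 * real n)" for S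
      unfolding m_def p_eq by simp
    with bad obtain S where S: "S \<subseteq> V" "S \<noteq> {}" "real (card S) \<le> 0.8 * real n"
      "real (card (edge_boundary E S)) \<le> m S / 2"
      unfolding large_boundaries_def not_all not_imp not_less by metis
    then show "\<exists>S\<in>?I. - (m S / 4) \<le> - 1 / 2 * real (card (E \<inter> cross_edges S (V - S)))"
      using edge_boundary_eq_cross[OF E S(1)] by (intro bexI[of _ S]) auto
  next
    fix S assume S: "S \<in> ?I"
    let ?F = "cross_edges S (V - S)"
    have F: "?F \<subseteq> all_edges V"
      using S by (intro cross_edges_subset) auto
    have m: "real (card ?F) * p = m S"
      unfolding m_def by (subst card_cross_edges) auto
    have "0.2 * real n \<le> real (card (V - S))"
      using S real_card_compl[of S] by auto
    then have "0.2 * real n * p \<le> real (card (V - S)) * p"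
      using p_pos by (intro mult_right_mono) auto
    then have "30 * L \<le> real (card (V - S)) * p"
      using d_ge n_mult_p by simp
    then have "real (card S) * (30 * L) \<le> m S"
      unfolding m_def mult.assoc by (intro mult_left_mono) auto
    moreover have "0 \<le> real (card S) * L"
      using L_ge_1 by simp
    moreover have "m S * (exp (- 1 / 2) - 1) \<le> m S * (31 / 50 - 1)"
      using exp_minus_half_le p_pos[THEN less_imp_le] unfolding m_def
      by (intro mult_left_mono mult_nonneg_nonneg) auto
    ultimately have "m S * (exp (- 1 / 2) - 1) + m S / 4 \<le> real (card S) * (- 3 * L)"
      by simp
    then have "measure_pmf.prob G {E. - (m S / 4) \<le> - 1 / 2 * real (card (E \<inter> ?F))}
        \<le> exp (real (card S) * (- 3 * L))"
      using m by (intro order.trans[OF chernoff[OF F]]) simp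
    then show "measure_pmf.prob G {E. - (m S / 4) \<le> - 1 / 2 * real (card (E \<inter> ?F))}
        \<le> exp (- 3 * L) ^ card S"
      by (simp only: exp_of_nat_mult)
  qed
  also have "\<dots> \<le> exp (real n powr - 2) - 1"
    by (rule sum_nonempty_subsets_le) auto
  finally show ?thesis .
qed

text \<open>The set reached from \<open>u\<close> or its complement has at most 0.8n vertices. Its
  boundary is then non-empty, which gives an edge leaving the reached set.\<close>

lemma connected_if_large_boundaries:
  assumes E: "E \<subseteq> all_edges V" and large: "large_boundaries n \<alpha> E"
  shows "graph_connected V E"
  unfolding graph_connected_def
proof (intro conjI ballI)
  show "V \<noteq> {}" using n_ge by auto
next
  fix u v assume uv: "u \<in> V" "v \<in> V"
  have ex: "\<exists>x\<in>S. \<exists>y\<in>V - S. {x, y} \<in> E"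
    if S: "S \<subseteq> V" "S \<noteq> {}" "real (card S) \<le> 0.8 * real n" for S
  proof -
    have "0 \<le> real (card S) * real (card (V - S)) * \<alpha> * L / (2 * real n)"
      using \<alpha>_ge L_ge_1 by (intro divide_nonneg_nonneg mult_nonneg_nonneg) auto
    also have "\<dots> < real (card (edge_boundary E S))"
      using large S unfolding large_boundaries_def by blast
    finally have "E \<inter> cross_edges S (V - S) \<noteq> {}"
      using edge_boundary_eq_cross[OF E S(1)] by (metis card.empty of_nat_0 less_irrefl)
    then show ?thesis unfolding cross_edges_def by auto
  qed
  show "(u, v) \<in> (adj E)\<^sup>*"
  proof (rule ccontr)
    assume nv: "(u, v) \<notin> (adj E)\<^sup>*"
    define S where "S = {x \<in> V. (u, x) \<in> (adj E)\<^sup>*}"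
    have S: "S \<subseteq> V" "u \<in> S" "v \<in> V - S"
      using uv nv by (auto simp: S_def)
    have closed: False if "x \<in> S" "y \<in> V - S" "{x, y} \<in> E" for x y
      using that unfolding S_def adj_def by (auto intro: rtrancl_into_rtrancl)
    have card: "real (card (V - S)) = real n - real (card S)"
      using S by (intro real_card_compl) auto
    show False
    proof (cases "real (card S) \<le> 0.8 * real n")
      case True
      with ex[of S] S closed show False by blast
    next
      case False
      then have "real (card (V - S)) \<le> 0.8 * real n"
        using card by simp
      with ex[of "V - S"] S have "\<exists>x\<in>V - S. \<exists>y\<in>V - (V - S). {x, y} \<in> E"
        by blast
      then show False
        using closed by (metis Diff_iff insert_commute)
    qed
  qed
qed


text \<open>Each vertex deviates in a given direction with probability at most e n^(-5/4); the union
  is over n vertices and two directions.\<close>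

lemma prob_not_degrees_concentrated:
  "measure_pmf.prob G {E. \<not> degrees_concentrated n \<alpha> E} \<le> 2 * exp 1 * real n powr - (1 / 4)"
proof -
  \<comment> \<open>With s = \<theta> sqrt(\<alpha>), the exponent is -(2s - (4/5) s^2) L up to an
    additive constant; s = 5/4 maximises the bracket, with value 5/4.\<close>
  define \<theta> where "\<theta> = 5 / (4 * sqrt \<alpha>)"
  have "sqrt 144 \<le> sqrt \<alpha>"
    using \<alpha>_ge by (intro real_sqrt_le_mono) simp
  moreover have "sqrt 144 = 12"
    by (rule real_sqrt_unique) auto
  ultimately have sq: "12 \<le> sqrt \<alpha>" by simp
  have sq2: "sqrt \<alpha> * sqrt \<alpha> = \<alpha>"
    using \<alpha>_ge by simp
  have \<theta>_sqrt: "\<theta> * sqrt \<alpha> = 5 / 4"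
    using \<alpha>_ge unfolding \<theta>_def by simp
  have "\<alpha> * \<theta>\<^sup>2 = (\<theta> * sqrt \<alpha>)\<^sup>2"
    using \<alpha>_ge by (simp add: power_mult_distrib)
  moreover have "0 < \<theta>"
    using \<alpha>_ge by (simp add: \<theta>_def)
  moreover from this have "\<theta> * 12 \<le> \<theta> * sqrt \<alpha>"
    using sq by (intro mult_left_mono) auto
  ultimately have \<theta>: "0 < \<theta>" "\<theta> \<le> 3 / 25" "\<theta> * sqrt \<alpha> = 5 / 4" "\<alpha> * \<theta>\<^sup>2 = 25 / 16"
    using \<theta>_sqrt by (auto simp: power2_eq_square)
  let ?I = "V \<times> {1, - 1 :: real}"
  let ?F = "\<lambda>v. cross_edges {v} (V - {v})"
  \<comment> \<open>The sign \<sigma> selects the upper or the lower tail, and 5/2 is 2 \<theta>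
    sqrt(\<alpha>).\<close>
  let ?Q = "\<lambda>(v, \<sigma>) E. \<sigma> * \<theta> * (\<alpha> * L) + 5 / 2 * L \<le> (\<sigma> * \<theta>) * real (card (E \<inter> ?F v))"
  have "measure_pmf.prob G {E. \<not> degrees_concentrated n \<alpha> E} \<le> (\<Sum>i\<in>?I. exp (1 - 5 / 4 * L))"
  proof (rule prob_union_bound[where Q = ?Q])
    show "finite ?I" by simp
  next
    fix E assume "E \<in> set_pmf G" and bad: "\<not> degrees_concentrated n \<alpha> E"
    then have E: "E \<subseteq> all_edges V" by (intro set_pmf_gnp)
    \<comment> \<open>Hence the deviation 2 sqrt(\<alpha>) L is at most \<alpha> L / 6, and the
      first clause implies the other two.\<close>
    have "12 * sqrt \<alpha> \<le> \<alpha>"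
      using mult_right_mono[OF sq, of "sqrt \<alpha>"] sq sq2 by simp
    then have "12 * sqrt \<alpha> * L \<le> \<alpha> * L"
      using L_ge_1 by (intro mult_right_mono) auto
    then have "5 * \<alpha> / 6 * L \<le> x \<and> x \<le> 4 * \<alpha> / 3 * L" if "\<bar>x - \<alpha> * L\<bar> \<le> 2 * sqrt \<alpha> * L" for x
      using that unfolding abs_le_iff by (intro conjI) linarith+
    with bad obtain v where v: "v \<in> V" "2 * sqrt \<alpha> * L < \<bar>real (deg E v) - \<alpha> * L\<bar>"
      unfolding degrees_concentrated_def by (meson not_le)
    obtain \<sigma> :: real where \<sigma>: "\<sigma> \<in> {1, - 1}" "2 * sqrt \<alpha> * L \<le> \<sigma> * (real (deg E v) - \<alpha> * L)"
    proof (cases "real (deg E v) \<ge> \<alpha> * L")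
      case True
      with v that[of 1] show ?thesis by simp
    next
      case False
      with v that[of "- 1"] show ?thesis by simp
    qed
    from mult_left_mono[OF \<sigma>(2), of \<theta>] \<theta>
    have "2 * (\<theta> * sqrt \<alpha>) * L \<le> \<theta> * (\<sigma> * (real (deg E v) - \<alpha> * L))"
      by (simp add: algebra_simps)
    then have "?Q (v, \<sigma>) E"
      unfolding \<theta>(3) deg_eq_cross[OF E v(1)] by (simp add: algebra_simps)
    with \<sigma> v show "\<exists>i\<in>?I. ?Q i E" by blast
  next
    fix i assume "i \<in> ?I"
    then obtain v \<sigma> where i: "i = (v, \<sigma>)" "v \<in> V" "\<sigma> = 1 \<or> \<sigma> = - 1" by auto
    have F: "?F v \<subseteq> all_edges V"
      using i by (intro cross_edges_subset) auto
    \<comment> \<open>The mean is (n - 1) p rather than n p; the missing p \<le> 1 costs only a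
      factor e.\<close>
    have "real (card (?F v)) * p = \<alpha> * L - p"
      using i n_ge n_mult_p by (subst card_cross_edges) (auto simp: of_nat_diff algebra_simps)
    then have "real (card (?F v)) * p * (exp (\<sigma> * \<theta>) - 1) =
        \<alpha> * L * (exp (\<sigma> * \<theta>) - 1) - p * (exp (\<sigma> * \<theta>) - 1)"
      by (simp add: left_diff_distrib)
    also have "\<dots> \<le> \<alpha> * L * (\<sigma> * \<theta> + 4 / 5 * \<theta>\<^sup>2) + 1"
    proof -
      have "exp (\<sigma> * \<theta>) - 1 \<le> \<sigma> * \<theta> + 4 / 5 * \<theta>\<^sup>2"
        using exp_le_quadratic_pos[of \<theta>] exp_le_quadratic_neg[of \<theta>] \<theta> i by auto
      then have "\<alpha> * L * (exp (\<sigma> * \<theta>) - 1) \<le> \<alpha> * L * (\<sigma> * \<theta> + 4 / 5 * \<theta>\<^sup>2)"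
        using \<alpha>_ge L_ge_1 by (intro mult_left_mono) auto
      moreover have "p * (1 - exp (\<sigma> * \<theta>)) \<le> p * 1"
        using p_pos by (intro mult_left_mono) auto
      ultimately show ?thesis
        using p_le_1 by (simp add: algebra_simps)
    qed
    also have "\<dots> = \<sigma> * \<theta> * (\<alpha> * L) + 4 / 5 * (\<alpha> * \<theta>\<^sup>2) * L + 1"
      by (simp add: algebra_simps)
    finally have "real (card (?F v)) * p * (exp (\<sigma> * \<theta>) - 1) - (\<sigma> * \<theta> * (\<alpha> * L) + 5 / 2 * L)
        \<le> 1 - 5 / 4 * L"
      unfolding \<theta>(4) by simp
    then show "measure_pmf.prob G {E. ?Q i E} \<le> exp (1 - 5 / 4 * L)"
      unfolding i(1) prod.case by (intro order.trans[OF chernoff[OF F]]) simp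
  qed
  also have "exp (1 - 5 / 4 * L) = exp 1 * exp (- (5 / 4 * L))"
    by (simp flip: exp_add)
  also have "(\<Sum>i\<in>?I. exp 1 * exp (- (5 / 4 * L))) = 2 * exp 1 * (exp L * exp (- (5 / 4 * L)))"
    unfolding exp_L by (simp add: card_cartesian_product)
  also have "exp L * exp (- (5 / 4 * L)) = exp (- (1 / 4) * L)"
    by (simp only: exp_add[symmetric]) simp
  also have "\<dots> = real n powr - (1 / 4)"
    using n_pos by (simp add: powr_def)
  finally show ?thesis .
qed


end

subsection \<open>Edges to heavy neighbours\<close>

context gnp_regime
begin

text \<open>\<open>\<theta>\<close> weights the inequality |E(A,U)| > m and \<open>\<mu>\<close> the
  inequality |E(A,U)| \<ge> T|U|. The equation for \<open>\<theta> + \<mu>\<close> is the optimal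
  Chernoff parameter for the threshold T|U|, as each vertex of U expects a p edges to A. It bounds
  the moment term by T per vertex, and the sum over U is at most (1 + x)^n with x = exp(T - \<mu>
  T).\<close>

lemma prob_many_heavy_edges:
  assumes A: "A \<subseteq> V" and a: "a = real (card A)" and T: "0 \<le> \<theta>" "0 \<le> \<mu>"
    and s: "a * p * exp (\<theta> + \<mu>) = T"
  shows "measure_pmf.prob G {E. m < real (card (edges_between E A (heavy_neighbours n E A T)))}
           \<le> exp (real n * exp (T - \<mu> * T) - \<theta> * m)"
proof -
  have finA: "finite A"
    using A by (rule finite_subset) simp
  let ?F = "\<lambda>U. cross_edges A U"
  let ?Q = "\<lambda>U E. \<theta> * m + \<mu> * (T * real (card U)) \<le> (\<theta> + \<mu>) * real (card (E \<inter> ?F U))"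
  let ?x = "exp (T - \<mu> * T)"
  have "measure_pmf.prob G {E. m < real (card (edges_between E A (heavy_neighbours n E A T)))}
      \<le> (\<Sum>U\<in>Pow (V - A). exp (- (\<theta> * m)) * ?x ^ card U)"
  proof (rule prob_union_bound[where Q = ?Q])
    show "finite (Pow (V - A))" by simp
  next
    fix E assume m: "m < real (card (edges_between E A (heavy_neighbours n E A T)))"
    define U where "U = heavy_neighbours n E A T"
    have U: "U \<subseteq> V - A"
      unfolding U_def heavy_neighbours_def ext_nbhd_def by auto
    then have finU: "finite U"
      by (rule finite_subset) simp
    have "T * real (card U) = (\<Sum>u\<in>U. T)" by simp
    also have "\<dots> \<le> (\<Sum>u\<in>U. real (card (E \<inter> cross_edges {u} A)))"
      by (intro sum_mono) (auto simp: U_def heavy_neighbours_def edges_between_eq_cross)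
    also have "\<dots> = real (card (E \<inter> ?F U))"
      using U finU finA by (subst card_cross_edges_sum) auto
    finally have "\<mu> * (T * real (card U)) \<le> \<mu> * real (card (E \<inter> ?F U))"
      using T by (intro mult_left_mono)
    moreover have "\<theta> * m \<le> \<theta> * real (card (E \<inter> ?F U))"
      using T m unfolding U_def edges_between_eq_cross by (intro mult_left_mono) auto
    ultimately have "?Q U E"
      by (simp add: distrib_right)
    with U show "\<exists>U\<in>Pow (V - A). ?Q U E" by blast
  next
    fix U assume U: "U \<in> Pow (V - A)"
    have F: "?F U \<subseteq> all_edges V"
      using A U by (intro cross_edges_subset) auto
    have "real (card (?F U)) = real (card U) * a"
      using U unfolding a by (subst card_cross_edges) auto
    moreover have "0 \<le> a * p"
      unfolding a using p_pos[THEN less_imp_le] by (intro mult_nonneg_nonneg) auto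
    then have "0 \<le> real (card U) * (a * p)"
      by simp
    ultimately have "real (card (?F U)) * p * (exp (\<theta> + \<mu>) - 1) \<le> real (card U) * T"
      unfolding s[symmetric] by (simp add: right_diff_distrib mult.assoc)
    then have "real (card (?F U)) * p * (exp (\<theta> + \<mu>) - 1) - (\<theta> * m + \<mu> * (T * real (card U)))
        \<le> - (\<theta> * m) + real (card U) * (T - \<mu> * T)"
      by (simp add: algebra_simps)
    then have "measure_pmf.prob G {E. ?Q U E} \<le> exp (- (\<theta> * m) + real (card U) * (T - \<mu> * T))"
      by (intro order.trans[OF chernoff[OF F]]) simp
    then show "measure_pmf.prob G {E. ?Q U E} \<le> exp (- (\<theta> * m)) * ?x ^ card U"
      by (simp only: exp_add exp_of_nat_mult)
  qed
  also have "\<dots> = exp (- (\<theta> * m)) * (\<Sum>U\<in>Pow (V - A). ?x ^ card U)"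
    by (simp add: sum_distrib_left)
  also have "\<dots> \<le> exp (- (\<theta> * m)) * (\<Sum>U\<in>Pow V. ?x ^ card U)"
    by (intro mult_left_mono sum_mono2) auto
  also have "\<dots> \<le> exp (- (\<theta> * m)) * exp (real (card V) * ?x)"
    by (intro mult_left_mono sum_Pow_power_card_le) auto
  also have "\<dots> = exp (real n * ?x - \<theta> * m)"
    by (simp flip: exp_add)
  finally show ?thesis .
qed

text \<open>The two ranges of |A| differ in whether a vertex outside A expects at least one edge to
  A. Both use \<open>prob_many_heavy_edges\<close> with \<theta> = (ln K) / 2, where ln K \<ge> 4
  supplies the slack.\<close>

lemma prob_not_few_heavy_edges:
  assumes K: "exp 4 \<le> K"
  shows "measure_pmf.prob G {E. \<not> few_heavy_edges n \<alpha> K E}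
    \<le> exp (real n * real n powr (- (75 / K)) - real n / (2 * K)) + (exp (real n powr - 2) - 1)"
proof -
  define d where "d = \<alpha> * L"
  have d: "150 * L \<le> d" "0 < d" "p = d / real n"
    using d_ge L_ge_1 by (auto simp: d_def p_eq)
  have "0 < K"
    using K by (rule order.strict_trans2[rotated]) simp
  have lnK: "4 \<le> ln K"
    using K \<open>0 < K\<close> by (simp add: ln_ge_iff)
  have "1 + 4 \<le> exp (4 :: real)"
    by (rule exp_ge_add_one_self)
  then have K4: "4 \<le> K"
    using K by linarith
  let ?e = "\<lambda>A E T. real (card (edges_between E A (heavy_neighbours n E A T)))"
  let ?bad1 = "\<lambda>A E. real (card A) * d / K < ?e A E (K * real (card A) * d / real n)"
  let ?bad2 = "\<lambda>A E. real (card A) * d / ln K < ?e A E K"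
  let ?Q = "\<lambda>A E. (real n \<le> real (card A) * d \<and> ?bad1 A E) \<or> (real (card A) * d < real n \<and> ?bad2 A E)"
  let ?b1 = "\<lambda>A. exp (- (real n / (2 * K))) * exp (- (75 * L / K)) ^ card A"
  let ?b2 = "\<lambda>A. exp (- 3 * L) ^ card A :: real"
  have "measure_pmf.prob G {E. \<not> few_heavy_edges n \<alpha> K E}
      \<le> (\<Sum>A\<in>Pow V - {{}}. if real n \<le> real (card A) * d then ?b1 A else ?b2 A)"
  proof (rule prob_union_bound[where Q = ?Q])
    show "finite (Pow V - {{}})" by simp
  next
    fix E assume "\<not> few_heavy_edges n \<alpha> K E"
    then obtain A where A: "A \<subseteq> V" "A \<noteq> {}"
      "(real n / d \<le> real (card A) \<and> ?bad1 A E) \<or> (real (card A) < real n / d \<and> ?bad2 A E)"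
      unfolding few_heavy_edges_def d_def by (auto simp: not_le mult.assoc)
    moreover have "real n / d \<le> real (card A) \<longleftrightarrow> real n \<le> real (card A) * d"
      "real (card A) < real n / d \<longleftrightarrow> real (card A) * d < real n"
      using d by (auto simp: field_simps)
    ultimately show "\<exists>A\<in>Pow V - {{}}. ?Q A E" by blast
  next
    fix A assume A: "A \<in> Pow V - {{}}"
    define a where "a = real (card A)"
    have "finite A"
      using A by (auto intro: finite_subset)
    then have a: "1 \<le> a"
      using A by (simp add: a_def Suc_le_eq card_gt_0_iff)
    \<comment> \<open>Here \<open>\<mu>\<close> is the expected number of edges from a vertex
      outside \<open>A\<close> to \<open>A\<close>, not the weight of the same name in
      \<open>prob_many_heavy_edges\<close>. The cases below are \<mu> \<ge> 1 and \<mu> < 1.\<close>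
    define \<mu> where "\<mu> = a * p"
    have "0 < \<mu>"
      unfolding \<mu>_def using a p_pos by (intro mult_pos_pos) auto
    then have \<mu>: "0 < \<mu>" "real n * \<mu> = a * d"
      using n_pos by (auto simp: \<mu>_def d_def p_eq)
    show "measure_pmf.prob G {E. ?Q A E} \<le> (if real n \<le> real (card A) * d then ?b1 A else ?b2 A)"
    proof (cases "real n \<le> a * d")
      case True
      then have "real n * 1 \<le> real n * \<mu>"
        using \<mu> by simp
      then have \<mu>1: "1 \<le> \<mu>"
        using n_pos by simp
      \<comment> \<open>The threshold is T = K \<mu>, so the total parameter is ln K; it is split
        evenly.\<close>
      have "a * p * exp (ln K / 2 + ln K / 2) = K * a * d / real n"
        using \<open>0 < K\<close> d(3) by simp
      from prob_many_heavy_edges[OF _ a_def _ _ this, of "a * d / K"] A lnK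
      have "measure_pmf.prob G {E. a * d / K < ?e A E (K * a * d / real n)}
          \<le> exp (real n * exp (K * \<mu> - ln K / 2 * (K * \<mu>)) - ln K / 2 * (a * d / K))"
        using d by (simp add: \<mu>_def mult.assoc)
      \<comment> \<open>The sum over U costs at most a d / K in the exponent, while \<theta> m is at
        least 2 a d / K.\<close>
      also have "\<dots> \<le> exp (- (a * d / K))"
      proof -
        have "2 * (K * \<mu>) \<le> ln K / 2 * (K * \<mu>)"
          using lnK \<open>0 < K\<close> \<mu> by (intro mult_right_mono) auto
        then have "exp (K * \<mu> - ln K / 2 * (K * \<mu>)) \<le> exp (- (K * \<mu>))"
          by simp
        also have "\<dots> \<le> \<mu> / K"
        proof -
          have "K * 1 \<le> K * \<mu>"
            using \<mu>1 \<open>0 < K\<close> by (intro mult_left_mono) auto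
          also have "\<dots> \<le> exp (K * \<mu>)"
            using exp_ge_add_one_self[of "K * \<mu>"] by linarith
          finally have "1 / exp (K * \<mu>) \<le> 1 / K"
            using \<open>0 < K\<close> by (intro divide_left_mono) auto
          also have "\<dots> \<le> \<mu> / K"
            using \<mu>1 \<open>0 < K\<close> by (intro divide_right_mono) auto
          finally show ?thesis by (simp add: exp_minus field_simps)
        qed
        finally have "real n * exp (K * \<mu> - ln K / 2 * (K * \<mu>)) \<le> real n * (\<mu> / K)"
          by (intro mult_left_mono) auto
        also have "\<dots> = a * d / K"
          using \<mu> by simp
        finally have "real n * exp (K * \<mu> - ln K / 2 * (K * \<mu>)) \<le> a * d / K" .
        moreover have "2 * (a * d / K) \<le> ln K / 2 * (a * d / K)"
          using lnK \<open>0 < K\<close> a d by (intro mult_right_mono) auto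
        ultimately show ?thesis by simp
      qed
      \<comment> \<open>Half of a d / K gives the global factor exp(-n / (2K)), the other half the
        weights n^(-75/K) per element of A. The sum of these weights over A is at most exp(n^(1 -
        75/K)), which the global factor absorbs for large n.\<close>
      also have "\<dots> \<le> ?b1 A"
      proof -
        have "real n / (2 * K) \<le> a * d / (2 * K)"
          using True \<open>0 < K\<close> by (intro divide_right_mono) auto
        moreover have "a * (75 * L / K) \<le> a * d / (2 * K)"
          using d a \<open>0 < K\<close> by (simp add: field_simps)
        moreover have "a * d / K = a * d / (2 * K) + a * d / (2 * K)"
          by simp
        ultimately have "- (a * d / K) \<le> - (real n / (2 * K)) + a * (- (75 * L / K))"
          by linarith
        then have "exp (- (a * d / K)) \<le> exp (- (real n / (2 * K)) + a * (- (75 * L / K)))"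
          by (simp only: exp_le_cancel_iff)
        then show ?thesis
          unfolding a_def by (simp only: exp_add exp_of_nat_mult)
      qed
      finally show ?thesis
        using True by (simp add: a_def not_less[symmetric])
    next
      case False
      then have "real n * \<mu> < real n * 1"
        using \<mu> by simp
      then have \<mu>1: "\<mu> < 1"
        using n_pos by simp
      \<comment> \<open>The threshold is T = K, so the total parameter is ln (K / \<mu>). Giving the
        part -ln \<mu> to the second weight puts a factor \<mu> into x, so that n x is at most a
        quarter of n \<mu> = a d.\<close>
      have "a * p * exp (ln K / 2 + (ln K / 2 - ln \<mu>)) = K"
      proof -
        have "exp (ln K / 2 + (ln K / 2 - ln \<mu>)) = K / \<mu>"
          using \<open>0 < K\<close> \<mu> by (simp add: exp_diff)
        then show ?thesis
          unfolding \<mu>_def[symmetric] using \<mu> by simp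
      qed
      moreover have "ln \<mu> < 0"
        using \<mu> \<mu>1 by simp
      ultimately
      have "measure_pmf.prob G {E. a * d / ln K < ?e A E K}
          \<le> exp (real n * exp (K - (ln K / 2 - ln \<mu>) * K) - a * d / 2)"
        using prob_many_heavy_edges[of A a "ln K / 2" "ln K / 2 - ln \<mu>" K "a * d / ln K"] A lnK
        by (simp add: a_def)
      also have "\<dots> \<le> ?b2 A"
      proof -
        have "2 * K \<le> ln K / 2 * K"
          using lnK \<open>0 < K\<close> by (intro mult_right_mono) auto
        moreover have "K * ln \<mu> \<le> 1 * ln \<mu>"
          using \<mu> \<mu>1 K4 by (intro mult_right_mono_neg) auto
        ultimately have "K - (ln K / 2 - ln \<mu>) * K \<le> - K + ln \<mu>"
          by (simp add: algebra_simps)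
        then have "exp (K - (ln K / 2 - ln \<mu>) * K) \<le> exp (- K + ln \<mu>)"
          by simp
        also have "\<dots> = \<mu> / exp K"
          using \<mu> by (simp add: exp_diff)
        also have "\<dots> \<le> \<mu> / 4"
        proof (intro divide_left_mono)
          show "4 \<le> exp K"
            using K4 exp_ge_add_one_self[of K] by linarith
        qed (use \<mu> in auto)
        finally have "real n * exp (K - (ln K / 2 - ln \<mu>) * K) \<le> real n * (\<mu> / 4)"
          by (intro mult_left_mono) auto
        also have "\<dots> = a * d / 4"
          using \<mu> by simp
        finally have "real n * exp (K - (ln K / 2 - ln \<mu>) * K) - a * d / 2 \<le> - (a * d / 4)"
          by simp
        also have "\<dots> \<le> a * (- 3 * L)"
          using a d L_ge_1 mult_left_mono[of "12 * L" d a] by simp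
        finally have "exp (real n * exp (K - (ln K / 2 - ln \<mu>) * K) - a * d / 2) \<le> exp (a * (- 3 * L))"
          by (simp only: exp_le_cancel_iff)
        then show ?thesis
          unfolding a_def by (simp only: exp_of_nat_mult)
      qed
      finally show ?thesis
        using False by (simp add: a_def)
    qed
  qed
  also have "\<dots> \<le> (\<Sum>A\<in>Pow V - {{}}. ?b1 A) + (\<Sum>A\<in>Pow V - {{}}. ?b2 A)"
    unfolding sum.distrib[symmetric] by (intro sum_mono) auto
  also have "(\<Sum>A\<in>Pow V - {{}}. ?b2 A) \<le> exp (real n powr - 2) - 1"
    by (rule sum_nonempty_subsets_le) simp
  also have "(\<Sum>A\<in>Pow V - {{}}. ?b1 A) \<le> (\<Sum>A\<in>Pow V. ?b1 A)"
    by (intro sum_mono2) auto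
  also have "\<dots> = exp (- (real n / (2 * K))) * (\<Sum>A\<in>Pow V. exp (- (75 * L / K)) ^ card A)"
    by (simp add: sum_distrib_left)
  also have "\<dots> \<le> exp (- (real n / (2 * K))) * exp (real (card V) * exp (- (75 * L / K)))"
    by (intro mult_left_mono sum_Pow_power_card_le) auto
  also have "\<dots> = exp (real n * real n powr (- (75 / K)) - real n / (2 * K))"
    using n_pos by (simp add: powr_def flip: exp_add)
  finally show ?thesis by simp
qed


end

subsection \<open>Vertices with few edges to a set\<close>

context gnp_regime
begin

text \<open>The set U of all light vertices receives at most (y/2)|U| edges from A, while each of
  its vertices expects at least y - 1. At \<theta> = -1/2 this has probability at most
  exp(-(y/10)|U|). A third of the exponent is kept for the sum over U; the rest, with |U| > a/2,
  gives exp(-(y/30) a).\<close>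

lemma prob_many_light_vertices:
  assumes A: "A \<subseteq> V" and a: "a = real (card A)" and y: "15 \<le> y" "y - 1 \<le> a * p"
  shows "measure_pmf.prob G
      {E. a / 2 < real (card {v \<in> V - A. real (card (edges_between E {v} A)) \<le> y / 2})}
    \<le> exp (real n * exp (- (y / 30)) - y / 30 * a)"
proof -
  have finA: "finite A"
    using A by (rule finite_subset) simp
  let ?F = "\<lambda>U. cross_edges A U"
  let ?Q = "\<lambda>U E. - (y / 4 * real (card U)) \<le> - 1 / 2 * real (card (E \<inter> ?F U))"
  let ?I = "{U \<in> Pow (V - A). a / 2 < real (card U)}"
  let ?x = "exp (- (y / 30))"
  have "measure_pmf.prob G
      {E. a / 2 < real (card {v \<in> V - A. real (card (edges_between E {v} A)) \<le> y / 2})}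
      \<le> (\<Sum>U\<in>?I. exp (- (y / 30 * a)) * ?x ^ card U)"
  proof (rule prob_union_bound[where Q = ?Q])
    show "finite ?I" by simp
  next
    fix E assume m: "a / 2 < real (card {v \<in> V - A. real (card (edges_between E {v} A)) \<le> y / 2})"
    define U where "U = {v \<in> V - A. real (card (edges_between E {v} A)) \<le> y / 2}"
    have U: "U \<subseteq> V - A"
      unfolding U_def by auto
    then have finU: "finite U"
      by (rule finite_subset) simp
    have "real (card (E \<inter> ?F U)) = (\<Sum>u\<in>U. real (card (E \<inter> cross_edges {u} A)))"
      using U finU finA by (subst card_cross_edges_sum) auto
    also have "\<dots> \<le> (\<Sum>u\<in>U. y / 2)"
      by (intro sum_mono) (auto simp: U_def edges_between_eq_cross)
    finally have "?Q U E"
      by (simp add: algebra_simps)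
    with U m show "\<exists>U\<in>?I. ?Q U E"
      unfolding U_def[symmetric] by blast
  next
    fix U assume U: "U \<in> ?I"
    have F: "?F U \<subseteq> all_edges V"
      using A U by (intro cross_edges_subset) auto
    have "real (card (?F U)) * p = real (card U) * (a * p)"
      using U unfolding a by (subst card_cross_edges) auto
    then have "real (card (?F U)) * p * (exp (- 1 / 2) - 1) = real (card U) * (a * p * (exp (- 1 / 2) - 1))"
      by simp
    also have "\<dots> \<le> real (card U) * ((y - 1) * (31 / 50 - 1))"
    proof (intro mult_left_mono)
      have "a * p * (exp (- 1 / 2) - 1) \<le> (y - 1) * (exp (- 1 / 2) - 1)"
        using y exp_minus_half_le by (intro mult_right_mono_neg) auto
      also have "\<dots> \<le> (y - 1) * (31 / 50 - 1)"
        using y exp_minus_half_le by (intro mult_left_mono) auto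
      finally show "a * p * (exp (- 1 / 2) - 1) \<le> (y - 1) * (31 / 50 - 1)" .
    qed auto
    \<comment> \<open>Here \<open>15 \<le> y\<close> absorbs the loss of 1 in
      \<open>y - 1\<close>.\<close>
    also have "\<dots> \<le> real (card U) * (- (y / 4) - y / 10)"
      using y by (intro mult_left_mono) auto
    finally have "real (card (?F U)) * p * (exp (- 1 / 2) - 1) - - (y / 4 * real (card U))
        \<le> - (y / 10 * real (card U))"
      by (simp add: algebra_simps)
    also have "\<dots> \<le> - (y / 30 * a) + real (card U) * - (y / 30)"
    proof -
      have "a / 2 * (y / 15) \<le> real (card U) * (y / 15)"
        using U y by (intro mult_right_mono) auto
      then show ?thesis by (simp add: field_simps)
    qed
    finally have "measure_pmf.prob G {E. ?Q U E} \<le> exp (- (y / 30 * a) + real (card U) * - (y / 30))"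
      by (intro order.trans[OF chernoff[OF F]]) simp
    then show "measure_pmf.prob G {E. ?Q U E} \<le> exp (- (y / 30 * a)) * ?x ^ card U"
      by (simp only: exp_add exp_of_nat_mult)
  qed
  also have "\<dots> = exp (- (y / 30 * a)) * (\<Sum>U\<in>?I. ?x ^ card U)"
    by (simp add: sum_distrib_left)
  also have "\<dots> \<le> exp (- (y / 30 * a)) * (\<Sum>U\<in>Pow V. ?x ^ card U)"
    by (intro mult_left_mono sum_mono2) auto
  also have "\<dots> \<le> exp (- (y / 30 * a)) * exp (real (card V) * ?x)"
    by (intro mult_left_mono sum_Pow_power_card_le) auto
  also have "\<dots> = exp (real n * ?x - y / 30 * a)"
    by (simp flip: exp_add)
  finally show ?thesis .
qed

text \<open>The exponent (y/30)|A| is halved: one half, with |A| \<ge> b, makes the whole bound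
  small, the other pays for the sum over A.\<close>

lemma prob_not_few_light_vertices:
  assumes l: "1 \<le> ln L"
  shows "measure_pmf.prob G {E. \<not> few_light_vertices n \<alpha> E}
    \<le> exp (2 * real n * L powr - (5 / 2) - 5 / 2 * (real n / L - 1))"
proof -
  define z where "z = ln L powr 1.5"
  define y where "y = \<alpha> * z"
  \<comment> \<open>A lower bound for |A| under both roundings. The subtracted 1 lowers the mean y
    by p \<le> 1, hence the \<open>y - 1\<close> in \<open>prob_many_light_vertices\<close>.\<close>
  define b where "b = real n * z / L - 1"
  have "ln L powr 1 \<le> z"
    unfolding z_def using l by (intro powr_mono) auto
  then have z: "ln L \<le> z" "1 \<le> z"
    using l by auto
  have y: "150 * z \<le> y"
    unfolding y_def using \<alpha>_ge z by (intro mult_right_mono) auto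
  let ?I = "{A \<in> Pow V. card A \<in> {nat \<lfloor>real n * z / L\<rfloor>, nat \<lceil>real n * z / L\<rceil>}}"
  let ?Q = "\<lambda>A E. real (card A) / 2 < real (card {v \<in> V - A. real (card (edges_between E {v} A)) \<le> y / 2})"
  let ?x = "exp (- (y / 60))"
  have "measure_pmf.prob G {E. \<not> few_light_vertices n \<alpha> E}
      \<le> (\<Sum>A\<in>?I. exp (real n * ?x - y / 60 * b) * ?x ^ card A)"
  proof (rule prob_union_bound[where Q = ?Q])
    show "finite ?I" by simp
  next
    fix E assume "\<not> few_light_vertices n \<alpha> E"
    then obtain A where "A \<subseteq> V" "?Q A E"
      "card A \<in> {nat \<lfloor>real n * z / L\<rfloor>, nat \<lceil>real n * z / L\<rceil>}"
      unfolding few_light_vertices_def y_def z_def not_all not_imp not_le by blast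
    then show "\<exists>A\<in>?I. ?Q A E" by blast
  next
    fix A assume A: "A \<in> ?I"
    have "0 \<le> real n * z / L"
      using z L_ge_1 by (intro divide_nonneg_nonneg mult_nonneg_nonneg) auto
    then have b: "b \<le> real (card A)"
      using A unfolding b_def by auto linarith+
    then have "b * p \<le> real (card A) * p"
      using p_pos[THEN less_imp_le] by (rule mult_right_mono)
    moreover have "b * p = y - p"
      using n_ge L_ge_1 unfolding b_def y_def p_eq by (simp add: field_simps)
    ultimately have "y - 1 \<le> real (card A) * p"
      using p_le_1 by linarith
    then have "measure_pmf.prob G {E. ?Q A E}
        \<le> exp (real n * exp (- (y / 30)) - y / 30 * real (card A))"
      using A y z by (intro prob_many_light_vertices) auto
    also have "\<dots> \<le> exp (real n * ?x - y / 60 * b + real (card A) * - (y / 60))"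
    proof -
      have "real n * exp (- (y / 30)) \<le> real n * ?x"
        using y z by (intro mult_left_mono) auto
      moreover have "y / 60 * b \<le> y / 60 * real (card A)"
        using b y z by (intro mult_left_mono) auto
      moreover have "y / 30 * real (card A) = y / 60 * real (card A) - real (card A) * - (y / 60)"
        by simp
      ultimately show ?thesis
        unfolding exp_le_cancel_iff by linarith
    qed
    finally show "measure_pmf.prob G {E. ?Q A E} \<le> exp (real n * ?x - y / 60 * b) * ?x ^ card A"
      by (simp only: exp_add exp_of_nat_mult)
  qed
  also have "\<dots> = exp (real n * ?x - y / 60 * b) * (\<Sum>A\<in>?I. ?x ^ card A)"
    by (simp add: sum_distrib_left)
  also have "\<dots> \<le> exp (real n * ?x - y / 60 * b) * (\<Sum>A\<in>Pow V. ?x ^ card A)"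
    by (intro mult_left_mono sum_mono2) auto
  also have "\<dots> \<le> exp (real n * ?x - y / 60 * b) * exp (real (card V) * ?x)"
    by (intro mult_left_mono sum_Pow_power_card_le) auto
  also have "\<dots> = exp (2 * real n * ?x - y / 60 * b)"
    by (simp flip: exp_add)
  also have "\<dots> \<le> exp (2 * real n * L powr - (5 / 2) - 5 / 2 * (real n / L - 1))"
  proof -
    \<comment> \<open>This is y \<ge> 150 z \<ge> 150 ln L, divided by 60.\<close>
    have "?x \<le> exp (- (5 / 2) * ln L)"
      using y z by simp
    also have "\<dots> = L powr - (5 / 2)"
      using L_ge_1 by (simp add: powr_def)
    finally have "2 * real n * ?x \<le> 2 * real n * L powr - (5 / 2)"
      by (intro mult_left_mono) auto
    moreover have "5 / 2 * (real n / L - 1) \<le> y / 60 * b"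
    proof (rule mult_mono)
      have "real n * 1 / L \<le> real n * z / L"
        using z L_ge_1 by (intro divide_right_mono mult_left_mono) auto
      then show "real n / L - 1 \<le> b"
        unfolding b_def by simp
      have "L \<le> real n"
        using ln_le_minus_one[OF n_pos] by simp
      then have "1 \<le> real n / L"
        using L_ge_1 by (subst le_divide_eq_1_pos) linarith+
      then show "0 \<le> real n / L - 1"
        by linarith
    qed (use y z in auto)
    ultimately show ?thesis
      unfolding exp_le_cancel_iff by linarith
  qed
  finally show ?thesis .
qed

end

subsection \<open>Sparse balls\<close>

text \<open>For v in V, the trees with k edges on vertices of V that contain v, each as vertex set
  and edge set. Describing them by how they are grown suits both the count and the induction along
  walks.\<close>

fun grown_trees :: "'a set \<Rightarrow> 'a \<Rightarrow> nat \<Rightarrow> ('a set \<times> 'a set set) set" where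
  "grown_trees V v 0 = {({v}, {})}"
| "grown_trees V v (Suc k) =
     (\<Union>(S, F)\<in>grown_trees V v k. (\<lambda>(x, y). (insert y S, insert {x, y} F)) ` (S \<times> (V - S)))"

lemma grown_trees_props:
  assumes "(S, F) \<in> grown_trees V v k" "v \<in> V" "finite V"
  shows "S \<subseteq> V \<and> v \<in> S \<and> card S = Suc k \<and> finite F \<and> card F = k \<and>
    F \<subseteq> all_edges V \<and> (\<forall>e\<in>F. e \<subseteq> S)"
  using assms
proof (induction k arbitrary: S F)
  case (Suc k)
  then obtain S' F' x y where *: "(S', F') \<in> grown_trees V v k" "x \<in> S'" "y \<in> V - S'"
    "S = insert y S'" "F = insert {x, y} F'" by auto
  note IH = Suc.IH[OF *(1) Suc.prems(2,3)]
  then have "finite S'"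
    using Suc.prems(3) by (auto intro: finite_subset)
  moreover have "{x, y} \<notin> F'"
    using IH * by auto
  moreover have "{x, y} \<in> all_edges V"
    using IH * by (auto simp: all_edges_def card_insert_if)
  ultimately show ?case
    using IH * by auto
qed auto

text \<open>A tree with k edges has k + 1 vertices to attach to and at most |V| vertices to attach,
  hence at most (k + 1)|V| extensions.\<close>

lemma card_grown_trees:
  assumes "v \<in> V" "finite V"
  shows "finite (grown_trees V v k) \<and> card (grown_trees V v k) \<le> fact k * card V ^ k"
proof (induction k)
  case (Suc k)
  let ?T = "grown_trees V v k"
  let ?ext = "\<lambda>(S, F). (\<lambda>(x, y). (insert y S, insert {x, y} F)) ` (S \<times> (V - S))"
  have ext: "finite (?ext t) \<and> card (?ext t) \<le> Suc k * card V" if "t \<in> ?T" for t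
  proof -
    obtain S F where t: "t = (S, F)" by (cases t)
    note props = grown_trees_props[OF that[unfolded t] assms]
    then have fin: "finite S"
      using assms by (auto intro: finite_subset)
    have "card (?ext t) \<le> card (S \<times> (V - S))"
      unfolding t prod.case using fin assms by (intro card_image_le) auto
    also have "\<dots> \<le> Suc k * card V"
      using props assms unfolding card_cartesian_product
      by (intro mult_le_mono card_mono) auto
    finally show ?thesis
      using fin assms by (simp add: t)
  qed
  have "card (\<Union>t\<in>?T. ?ext t) \<le> (\<Sum>t\<in>?T. card (?ext t))"
    using Suc by (intro card_UN_le) auto
  also have "\<dots> \<le> (\<Sum>t\<in>?T. Suc k * card V)"
    using ext by (intro sum_mono) blast
  also have "\<dots> \<le> fact k * card V ^ k * (Suc k * card V)"
    using Suc by (simp only: sum_constant of_nat_id mult_le_mono1)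
  finally have "card (grown_trees V v (Suc k)) \<le> fact (Suc k) * card V ^ Suc k"
    by (simp add: algebra_simps)
  moreover have "finite (grown_trees V v (Suc k))"
    using Suc ext by (simp only: grown_trees.simps) blast
  ultimately show ?case by blast
qed simp

text \<open>Only a step to a vertex outside the current tree enlarges it, by one vertex and one
  edge, so a walk of length j adds at most j edges. The restriction on \<open>R\<close> keeps
  \<open>w\<close> out.\<close>

lemma grow_along_walk:
  assumes "(u, x) \<in> R ^^ j" "R \<subseteq> adj E \<inter> (V - {w}) \<times> (V - {w})"
    and "(S, F) \<in> grown_trees V v k" "F \<subseteq> E" "u \<in> S" "w \<notin> S"
  shows "\<exists>S' F' k'. k' \<le> k + j \<and> (S', F') \<in> grown_trees V v k' \<and> F' \<subseteq> E \<and>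
    S \<subseteq> S' \<and> x \<in> S' \<and> w \<notin> S'"
  using assms(1)
proof (induction j arbitrary: x)
  case 0
  with assms show ?case by auto
next
  case (Suc j)
  then obtain y where y: "(u, y) \<in> R ^^ j" "(y, x) \<in> R" by auto
  from Suc.IH[OF y(1)] obtain S' F' k' where
    *: "k' \<le> k + j" "(S', F') \<in> grown_trees V v k'" "F' \<subseteq> E" "S \<subseteq> S'" "y \<in> S'" "w \<notin> S'"
    by blast
  show ?case
  proof (cases "x \<in> S'")
    case True
    with * show ?thesis
      by (intro exI[of _ S'] exI[of _ F'] exI[of _ k']) auto
  next
    case False
    have x: "x \<in> V" "x \<noteq> w" "{y, x} \<in> E"
      using y(2) assms(2) by (auto simp: adj_def)
    have "(insert x S', insert {y, x} F') \<in> grown_trees V v (Suc k')"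
      using * False x by force
    with * x show ?thesis
      by (intro exI[of _ "insert x S'"] exI[of _ "insert {y, x} F'"] exI[of _ "Suc k'"]) auto
  qed
qed

text \<open>Starting from the single vertex \<open>v\<close>, the walks to the elements of
  \<open>X\<close> are added one after another. All of them start at \<open>v\<close>, which every
  grown tree contains.\<close>

lemma grow_to_set:
  assumes "finite X" "v \<in> V" "v \<noteq> w" "R \<subseteq> adj E \<inter> (V - {w}) \<times> (V - {w})"
    and "\<And>x. x \<in> X \<Longrightarrow> \<exists>j\<le>r. (v, x) \<in> R ^^ j" "finite V"
  shows "\<exists>S F k. k \<le> card X * r \<and> (S, F) \<in> grown_trees V v k \<and> F \<subseteq> E \<and> X \<subseteq> S \<and> w \<notin> S"
  using assms(1,5)
proof (induction X rule: finite_induct)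
  case empty
  then show ?case
    using assms by (intro exI[of _ "{v}"] exI[of _ "{}"] exI[of _ 0]) auto
next
  case (insert x X)
  then obtain S F k where *: "k \<le> card X * r" "(S, F) \<in> grown_trees V v k" "F \<subseteq> E" "X \<subseteq> S" "w \<notin> S"
    by auto
  have "v \<in> S"
    using grown_trees_props[OF *(2) assms(2,6)] by blast
  from insert.prems obtain j where j: "j \<le> r" "(v, x) \<in> R ^^ j" by auto
  from grow_along_walk[OF j(2) assms(4) *(2,3) \<open>v \<in> S\<close> *(5)] obtain S' F' k' where
    "k' \<le> k + j" "(S', F') \<in> grown_trees V v k'" "F' \<subseteq> E" "S \<subseteq> S'" "x \<in> S'" "w \<notin> S'"
    by blast
  with * j insert.hyps show ?case
    by (intro exI[of _ S'] exI[of _ F'] exI[of _ k']) auto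
qed

section \<open>Distances, balls and spheres\<close>

lemma graph_dist_le_iff: "graph_dist E u x \<le> enat r \<longleftrightarrow> (\<exists>j\<le>r. (u, x) \<in> adj E ^^ j)"
proof
  assume *: "graph_dist E u x \<le> enat r"
  let ?D = "{enat k | k. (u, x) \<in> adj E ^^ k}"
  have "?D \<noteq> {}"
  proof
    assume "?D = {}"
    then have "graph_dist E u x = \<infinity>"
      unfolding graph_dist_def by (simp add: Inf_enat_def)
    with * show False by simp
  qed
  then obtain d where "d \<in> ?D" by blast
  \<comment> \<open>\<open>enat\<close> is well-ordered, so the infimum of a non-empty set of walk
    lengths is attained.\<close>
  then have "(LEAST x. x \<in> ?D) \<in> ?D" by (rule LeastI)
  with \<open>?D \<noteq> {}\<close> have "Inf ?D \<in> ?D"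
    unfolding Inf_enat_def by (simp only: if_False)
  with * show "\<exists>j\<le>r. (u, x) \<in> adj E ^^ j"
    unfolding graph_dist_def by auto
next
  assume "\<exists>j\<le>r. (u, x) \<in> adj E ^^ j"
  then obtain j where "j \<le> r" "(u, x) \<in> adj E ^^ j" by blast
  then show "graph_dist E u x \<le> enat r"
    unfolding graph_dist_def by (intro Inf_lower2[of "enat j"]) auto
qed

text \<open>A walk of length at most \<open>r\<close> reaches \<open>w\<close>, at distance exactly \<open>r\<close>, in its last step only.\<close>

lemma sphere_avoiding_walk:
  assumes E: "E \<subseteq> all_edges V" and v: "v \<in> V"
    and w: "w \<in> graph_sphere V E v r" and x: "x \<in> graph_ball V E v r" "x \<noteq> w"
  shows "\<exists>j\<le>r. (v, x) \<in> (adj E \<inter> (V - {w}) \<times> (V - {w})) ^^ j"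
proof -
  from x obtain j where j: "j \<le> r" "(v, x) \<in> adj E ^^ j"
    unfolding graph_ball_def by (auto simp: graph_dist_le_iff)
  then obtain f where f: "f 0 = v" "f j = x" "\<And>i. i < j \<Longrightarrow> (f i, f (Suc i)) \<in> adj E"
    by (auto simp: relpow_fun_conv)
  have wV: "w \<in> V"
    using w unfolding graph_sphere_def graph_ball_def by auto
  have ne: "f i \<noteq> w" if "i \<le> j" for i
  proof
    assume "f i = w"
    have "(v, f i) \<in> adj E ^^ i"
      unfolding relpow_fun_conv using f that by (intro exI[of _ f]) auto
    moreover have "i \<noteq> j"
      using \<open>f i = w\<close> f(2) x(2) by auto
    then have "i < r"
      using that j(1) by linarith
    \<comment> \<open>Since \<open>i < r\<close>, the radius r is positive: \<open>r - 1\<close> is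
      not truncated and the sphere excludes this ball.\<close>
    ultimately have "w \<in> graph_ball V E v (r - 1)"
      using wV \<open>f i = w\<close> unfolding graph_ball_def
      by (auto simp: graph_dist_le_iff intro!: exI[of _ i])
    with w \<open>i < r\<close> show False
      unfolding graph_sphere_def by auto
  qed
  have "adj E \<subseteq> V \<times> V"
    using E unfolding adj_def all_edges_def by auto
  then have "(f i, f (Suc i)) \<in> adj E \<inter> (V - {w}) \<times> (V - {w})" if "i < j" for i
    using f(3)[OF that] ne[of i] ne[of "Suc i"] that by auto
  with f j show ?thesis
    by (auto simp: relpow_fun_conv intro!: exI[of _ j] exI[of _ f])
qed

text \<open>Six neighbours of w in the ball are reached from v by walks of length at most r that
  avoid w, and these walks grow a tree with at most 6r edges. As w lies outside the tree, the six
  edges at w are not tree edges.\<close>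

lemma dense_vertex_tree:
  assumes E: "E \<subseteq> all_edges V" and V: "finite V" "v \<in> V"
    and w: "w \<in> graph_sphere V E v r"
    and many: "6 \<le> card (edges_between E {w} (graph_ball V E v r))"
  shows "\<exists>k S F X. k \<le> 6 * r \<and> (S, F) \<in> grown_trees V v k \<and> w \<in> V - S \<and>
    X \<subseteq> S \<and> card X = 6 \<and> F \<union> cross_edges {w} X \<subseteq> E"
proof -
  let ?N = "{x \<in> graph_ball V E v r. {w, x} \<in> E}"
  have finN: "finite ?N"
    using V unfolding graph_ball_def by auto
  have "edges_between E {w} (graph_ball V E v r) \<subseteq> (\<lambda>x. {w, x}) ` ?N"
    unfolding edges_between_def by auto
  then have "6 \<le> card ?N"
    using many finN by (meson card_image_le card_mono finite_imageI order.trans)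
  then obtain X where X: "X \<subseteq> ?N" "card X = 6" "finite X"
    by (rule obtain_subset_with_card_n)
  have ne: "x \<noteq> w" if "x \<in> X" for x
    using that X E unfolding all_edges_def by auto
  let ?R = "adj E \<inter> (V - {w}) \<times> (V - {w})"
  have walk: "\<exists>j\<le>r. (v, x) \<in> ?R ^^ j" if "x \<in> X" for x
    using that X ne by (intro sphere_avoiding_walk[OF E V(2) w]) auto
  obtain x where x: "x \<in> X"
    using X by fastforce
  \<comment> \<open>If v = w, then r = 0 and the ball is {v}, so w has no neighbour in it.\<close>
  have "v \<noteq> w"
  proof
    assume "v = w"
    with w have "r = 0"
      unfolding graph_sphere_def graph_ball_def by (auto simp: graph_dist_le_iff split: if_splits)
    with walk[OF x] ne[OF x] \<open>v = w\<close> show False by auto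
  qed
  from grow_to_set[OF X(3) V(2) this order.refl walk V(1)] X(2) obtain S F k where
    "k \<le> 6 * r" "(S, F) \<in> grown_trees V v k" "F \<subseteq> E" "X \<subseteq> S" "w \<notin> S" by auto
  moreover have "w \<in> V"
    using w unfolding graph_sphere_def graph_ball_def by auto
  moreover have "cross_edges {w} X \<subseteq> E"
    using X unfolding cross_edges_def by auto
  ultimately show ?thesis
    using X(2) by blast
qed

context gnp_regime
begin

text \<open>Given v and k, there are at most k! n^k trees, n choices of w and (2L)^6 of X, each
  configuration having probability p^(k+6). With np \<le> L^3, the factor k! (np)^k is at most
  n^(8/5). Summing over v as well leaves n^(8/5 - 4) times powers of L.\<close>

lemma prob_not_sparse_balls:
  assumes l: "1 \<le> ln L" and \<alpha>: "\<alpha> < L\<^sup>2"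
  shows "measure_pmf.prob G {E. \<not> sparse_balls n E} \<le> 64 * L ^ 25 * real n powr - 2"
proof -
  \<comment> \<open>The number of tree edges is at most six times the largest admissible
    radius.\<close>
  define R where "R = nat \<lfloor>6 * L / (15 * ln L)\<rfloor>"
  define I where "I = (SIGMA v : V. SIGMA k : {..R}. SIGMA t : grown_trees V v k.
    V \<times> {X. X \<subseteq> fst t \<and> card X = 6})"
  \<comment> \<open>The index \<open>w\<close> ranges over all of V, so the condition that it avoids
    the tree is put into the event, which is empty for w in the tree.\<close>
  let ?Q = "\<lambda>(v, k, t, w, X) E. snd t \<union> cross_edges {w} X \<subseteq> E \<and> w \<notin> fst t"
  have R: "real R \<le> 2 / 5 * L / ln L"
    using l L_ge_1 unfolding R_def by simp
  have finV: "finite V" by simp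
  have finT: "finite (grown_trees V v k)" if "v \<in> V" for v k
    using card_grown_trees[OF that finV] by blast
  have finX: "finite {X. X \<subseteq> fst t \<and> card X = 6}" if "v \<in> V" "t \<in> grown_trees V v k" for v k t
  proof -
    have "fst t \<subseteq> V"
      using grown_trees_props[of "fst t" "snd t", OF _ that(1) finV] that(2) by auto
    then have "finite (fst t)"
      by (rule finite_subset) simp
    then show ?thesis by simp
  qed
  note fin = finV finT finX
  then have "finite I"
    unfolding I_def by (intro finite_SigmaI finite_cartesian_product) auto
  have "measure_pmf.prob G {E. \<not> sparse_balls n E} \<le> (\<Sum>(v, k, t, w, X)\<in>I. p ^ (k + 6))"
  proof (rule prob_union_bound[where Q = ?Q])
    show "finite I" by fact
  next
    fix E assume "E \<in> set_pmf G" "\<not> sparse_balls n E"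
    then obtain v r w where E: "E \<subseteq> all_edges V" and v: "v \<in> V"
      and r: "real r \<le> L / (15 * ln L)"
      and w: "w \<in> graph_sphere V E v r" and "6 \<le> card (edges_between E {w} (graph_ball V E v r))"
      unfolding sparse_balls_def using set_pmf_gnp by force
    from dense_vertex_tree[OF E finV v w this(5)] obtain k S F X where
      *: "k \<le> 6 * r" "(S, F) \<in> grown_trees V v k" "w \<in> V - S" "X \<subseteq> S" "card X = 6"
        "F \<union> cross_edges {w} X \<subseteq> E" by blast
    have "real (6 * r) \<le> 6 * L / (15 * ln L)"
      using r by simp
    then have "6 * r \<le> R"
      unfolding R_def by linarith
    with * v have "(v, k, (S, F), w, X) \<in> I"
      unfolding I_def by auto
    with * show "\<exists>i\<in>I. ?Q i E"
      by (intro bexI[of _ "(v, k, (S, F), w, X)"]) auto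
  next
    fix i assume "i \<in> I"
    then obtain v k S F w X where i: "i = (v, k, (S, F), w, X)" "v \<in> V" "k \<le> R"
      "(S, F) \<in> grown_trees V v k" "w \<in> V" "X \<subseteq> S" "card X = 6"
      unfolding I_def by auto
    note props = grown_trees_props[OF i(4,2) finV]
    show "measure_pmf.prob G {E. ?Q i E} \<le> (case i of (v, k, t, w, X) \<Rightarrow> p ^ (k + 6))"
    proof (cases "w \<in> S")
      case True
      then show ?thesis
        using p_pos by (simp add: i(1))
    next
      case False
      let ?C = "cross_edges {w} X"
      have "card ?C = 6"
        using False i by (subst card_cross_edges) auto
      moreover have "F \<inter> ?C = {}"
        using props False unfolding cross_edges_def by auto
      ultimately have "card (F \<union> ?C) = k + 6"
        using props by (subst card_Un_disjoint) (auto intro: card_ge_0_finite)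
      moreover have "F \<union> ?C \<subseteq> all_edges V"
        using props i False by (intro Un_least cross_edges_subset) auto
      ultimately show ?thesis
        using gnp_prob_superset[OF p_pos[THEN less_imp_le] p_le_1, of "F \<union> ?C" n]
        by (simp add: i(1) False)
    qed
  qed
  also have "\<dots> = (\<Sum>v\<in>V. \<Sum>k\<le>R. \<Sum>t\<in>grown_trees V v k. \<Sum>w\<in>V.
      \<Sum>X | X \<subseteq> fst t \<and> card X = 6. p ^ (k + 6))"
    unfolding I_def using fin
    by (simp add: sum.Sigma sum.cartesian_product case_prod_unfold del: sum_constant)
  also have "\<dots> \<le> (\<Sum>v\<in>V. \<Sum>k\<le>R. L ^ 24 * real n powr (8 / 5) / real n ^ 5 * 64)"
  proof (intro sum_mono)
    fix v k assume v: "v \<in> V" and "k \<in> {..R}"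
    then have k: "real k \<le> 2 / 5 * L / ln L"
      using R by auto
    also have "\<dots> \<le> 2 / 5 * L / 1"
      using l L_ge_1 by (intro frac_le) auto
    finally have kL: "real k \<le> L"
      using L_ge_1 by simp
    let ?T = "grown_trees V v k"
    have "(\<Sum>t\<in>?T. \<Sum>w\<in>V. \<Sum>X | X \<subseteq> fst t \<and> card X = 6. p ^ (k + 6))
        \<le> (\<Sum>t\<in>?T. real n * ((2 * L) ^ 6 * p ^ (k + 6)))"
    proof (rule sum_mono)
      fix t assume "t \<in> ?T"
      then have "fst t \<subseteq> V" "card (fst t) = Suc k"
        using grown_trees_props[of "fst t" "snd t", OF _ v finV] by auto
      then have "card {X. X \<subseteq> fst t \<and> card X = 6} = Suc k choose 6"
        by (subst n_subsets) (auto intro: finite_subset)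
      also have "\<dots> \<le> Suc k ^ 6"
      proof (cases "6 \<le> Suc k")
        case True
        then show ?thesis by (rule binomial_le_pow)
      next
        case False
        then have "Suc k choose 6 = 0"
          by (intro binomial_eq_0) simp
        then show ?thesis by (metis le0)
      qed
      finally have "real (card {X. X \<subseteq> fst t \<and> card X = 6}) \<le> real (Suc k) ^ 6"
        by (metis of_nat_le_iff of_nat_power)
      also have "\<dots> \<le> (2 * L) ^ 6"
        using kL L_ge_1 by (intro power_mono) auto
      finally have "real n * (real (card {X. X \<subseteq> fst t \<and> card X = 6}) * p ^ (k + 6))
          \<le> real n * ((2 * L) ^ 6 * p ^ (k + 6))"
        using p_pos by (intro mult_left_mono mult_right_mono) auto
      then show "(\<Sum>w\<in>V. \<Sum>X | X \<subseteq> fst t \<and> card X = 6. p ^ (k + 6))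
          \<le> real n * ((2 * L) ^ 6 * p ^ (k + 6))"
        by simp
    qed
    also have "\<dots> = real (card ?T) * (real n * ((2 * L) ^ 6 * p ^ (k + 6)))"
      by simp
    also have "\<dots> \<le> (fact k * real n ^ k) * (real n * ((2 * L) ^ 6 * p ^ (k + 6)))"
    proof (rule mult_right_mono)
      have "real (card ?T) \<le> real (fact k * n ^ k)"
        using card_grown_trees[OF v finV, of k] by (simp only: of_nat_le_iff card_atLeastAtMost) simp
      then show "real (card ?T) \<le> fact k * real n ^ k" by simp
    qed (use p_pos L_ge_1 in auto)
    also have "\<dots> = (fact k * (real n * p) ^ k) * (real n * p) ^ 6 * L ^ 6 * 64 / real n ^ 5"
      using n_pos by (simp add: power_mult_distrib power_add field_simps eval_nat_numeral)
    also have "\<dots> \<le> real n powr (8 / 5) * L ^ 18 * L ^ 6 * 64 / real n ^ 5"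
    proof (intro divide_right_mono mult_right_mono mult_mono)
      have "\<alpha> * L \<le> L\<^sup>2 * L"
        using \<alpha> L_ge_1 by (intro mult_right_mono) auto
      then have d: "real n * p \<le> L ^ 3"
        unfolding n_mult_p by (simp add: eval_nat_numeral)
      have np: "0 \<le> real n * p"
        using p_pos by simp
      show "(real n * p) ^ 6 \<le> L ^ 18"
        using power_mono[OF d np, of 6] by (simp flip: power_mult)
      have "fact k \<le> real k ^ k"
        using fact_le_power[of k, where 'a = real] by simp
      also have "\<dots> \<le> L ^ k"
        using kL by (intro power_mono) auto
      finally have "fact k * (real n * p) ^ k \<le> L ^ k * (L ^ 3) ^ k"
        using d np L_ge_1 by (intro mult_mono power_mono) auto
      also have "\<dots> = (L ^ 4) ^ k"
        by (simp add: power_mult_distrib[symmetric] eval_nat_numeral)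
      also have "\<dots> = exp (4 * real k * ln L)"
      proof -
        have "L ^ 4 = exp (ln L) ^ 4"
          using L_ge_1 by simp
        also have "\<dots> = exp (4 * ln L)"
          by (simp flip: exp_of_nat_mult)
        finally show ?thesis
          by (simp flip: exp_of_nat_mult add: mult_ac)
      qed
      \<comment> \<open>The bound k \<le> (2/5) L / ln L comes from the constant 15 in the
        radius.\<close>
      also have "\<dots> \<le> exp (8 / 5 * L)"
        using k l by (simp add: field_simps)
      also have "\<dots> = real n powr (8 / 5)"
        using n_pos by (simp add: powr_def)
      finally show "fact k * (real n * p) ^ k \<le> real n powr (8 / 5)" .
    qed (use p_pos L_ge_1 in auto)
    also have "\<dots> = L ^ 24 * real n powr (8 / 5) / real n ^ 5 * 64"
      by (simp add: eval_nat_numeral)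
    finally show "(\<Sum>t\<in>?T. \<Sum>w\<in>V. \<Sum>X | X \<subseteq> fst t \<and> card X = 6. p ^ (k + 6))
        \<le> L ^ 24 * real n powr (8 / 5) / real n ^ 5 * 64" .
  qed
  also have "\<dots> = real (R + 1) * (64 * L ^ 24 * real n powr (8 / 5) / real n ^ 4)"
    using n_pos by (simp add: field_simps eval_nat_numeral)
  also have "\<dots> \<le> L * (64 * L ^ 24 * real n powr - 2)"
  proof (rule mult_mono)
    \<comment> \<open>This gives \<open>2 \<le> L\<close>, which absorbs the additional 1 in
      \<open>R + 1\<close>.\<close>
    have "exp 1 \<le> exp (ln L)"
      using l by simp
    then have "2 \<le> L"
      using exp_ge_add_one_self[of 1] L_ge_1 by simp
    moreover have "2 / 5 * L / ln L \<le> 2 / 5 * L / 1"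
      using l L_ge_1 by (intro frac_le) auto
    ultimately show "real (R + 1) \<le> L"
      using R by simp
    have "real n powr (8 / 5) / real n ^ 4 = real n powr (8 / 5 - 4)"
      using n_pos by (simp only: powr_diff) simp
    also have "\<dots> \<le> real n powr - 2"
      using n_ge by (intro powr_mono) auto
    finally have "64 * L ^ 24 * (real n powr (8 / 5) / real n ^ 4) \<le> 64 * L ^ 24 * real n powr - 2"
      using L_ge_1 by (intro mult_left_mono) auto
    then show "64 * L ^ 24 * real n powr (8 / 5) / real n ^ 4 \<le> 64 * L ^ 24 * real n powr - 2"
      by simp
  qed (use L_ge_1 in auto)
  also have "\<dots> = 64 * L ^ 25 * real n powr - 2"
    by (simp add: eval_nat_numeral)
  finally show ?thesis .
qed

end

subsection \<open>Asymptotics\<close>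

context gnp_regime
begin

text \<open>Connectivity follows from large boundaries, so five bad events remain. The condition
  \<alpha> < L^2 is part of the last one, which is empty if the condition fails. The term
  exp(n^(-2)) - 1 arises twice: from the boundaries and from the small sets in the heavy-edge
  property.\<close>

lemma prob_good_ge:
  assumes K: "exp 4 \<le> K" and l: "1 \<le> ln L"
    and good: "\<And>E. E \<subseteq> all_edges V \<Longrightarrow> graph_connected V E \<Longrightarrow> degrees_concentrated n \<alpha> E \<Longrightarrow>
      large_boundaries n \<alpha> E \<Longrightarrow> few_heavy_edges n \<alpha> K E \<Longrightarrow> few_light_vertices n \<alpha> E \<Longrightarrow>
      (\<alpha> < L\<^sup>2 \<longrightarrow> sparse_balls n E) \<Longrightarrow> P E"
  shows "1 - (2 * exp 1 * real n powr - (1 / 4) + 2 * (exp (real n powr - 2) - 1)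
      + exp (real n * real n powr (- (75 / K)) - real n / (2 * K))
      + exp (2 * real n * L powr - (5 / 2) - 5 / 2 * (real n / L - 1))
      + 64 * L ^ 25 * real n powr - 2)
    \<le> measure_pmf.prob G {E. P E}"
proof -
  define b where "b = (\<lambda>i::nat.
    [2 * exp 1 * real n powr - (1 / 4), exp (real n powr - 2) - 1,
     exp (real n * real n powr (- (75 / K)) - real n / (2 * K)) + (exp (real n powr - 2) - 1),
     exp (2 * real n * L powr - (5 / 2) - 5 / 2 * (real n / L - 1)),
     64 * L ^ 25 * real n powr - 2] ! i)"
  define Q where "Q = (\<lambda>i::nat.
    [\<lambda>E. \<not> degrees_concentrated n \<alpha> E, \<lambda>E. \<not> large_boundaries n \<alpha> E,
     \<lambda>E. \<not> few_heavy_edges n \<alpha> K E, \<lambda>E. \<not> few_light_vertices n \<alpha> E,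
     \<lambda>E. \<alpha> < L\<^sup>2 \<and> \<not> sparse_balls n E] ! i)"
  have "measure_pmf.prob G {E. \<not> P E} \<le> (\<Sum>i<5. b i)"
  proof (rule prob_union_bound[where Q = Q])
    fix E assume "E \<in> set_pmf G" "\<not> P E"
    then have "\<exists>i\<in>{0, 1, 2, 3, 4}. Q i E"
      using good[of E] set_pmf_gnp[of E n p] connected_if_large_boundaries[of E]
      unfolding Q_def by auto
    then show "\<exists>i\<in>{..<5}. Q i E" by auto
  next
    fix i :: nat assume "i \<in> {..<5}"
    then have "i = 0 \<or> i = 1 \<or> i = 2 \<or> i = 3 \<or> i = 4" by auto
    moreover have "measure_pmf.prob G {E. \<alpha> < L\<^sup>2 \<and> \<not> sparse_balls n E} \<le> 64 * L ^ 25 * real n powr - 2"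
      using prob_not_sparse_balls[OF l] L_ge_1 by (cases "\<alpha> < L\<^sup>2") auto
    ultimately show "measure_pmf.prob G {E. Q i E} \<le> b i"
      using prob_not_degrees_concentrated prob_not_large_boundaries
        prob_not_few_heavy_edges[OF K] prob_not_few_light_vertices[OF l]
      unfolding Q_def b_def by auto
  qed simp
  also have "(\<Sum>i<5. b i) = 2 * exp 1 * real n powr - (1 / 4) + 2 * (exp (real n powr - 2) - 1)
      + exp (real n * real n powr (- (75 / K)) - real n / (2 * K))
      + exp (2 * real n * L powr - (5 / 2) - 5 / 2 * (real n / L - 1))
      + 64 * L ^ 25 * real n powr - 2"
    by (simp add: b_def eval_nat_numeral)
  moreover have "measure_pmf.prob G {E. \<not> P E} = 1 - measure_pmf.prob G {E. P E}"
    using measure_pmf.prob_compl[of "{E. P E}" G] by (simp add: Compl_eq_Diff_UNIV[symmetric] Collect_neg_eq)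
  ultimately show ?thesis by linarith
qed

end

text \<open>n^(1 - 75/K) is of smaller order than n / (2K), and n L^(-5/2) than n / L with L = ln n,
  so both of these exponents tend to minus infinity.\<close>

lemma failure_bound_tendsto_0:
  fixes K :: real
  assumes "0 < K"
  shows "(\<lambda>n. 2 * exp 1 * real n powr - (1 / 4) + 2 * (exp (real n powr - 2) - 1)
      + exp (real n * real n powr (- (75 / K)) - real n / (2 * K))
      + exp (2 * real n * ln (real n) powr - (5 / 2) - 5 / 2 * (real n / ln (real n) - 1))
      + 64 * ln (real n) ^ 25 * real n powr - 2) \<longlonglongrightarrow> 0"
proof -
  have "(\<lambda>n. exp (real n * real n powr (- (75 / K)) - real n / (2 * K))) \<longlonglongrightarrow> 0"
    using assms by real_asymp
  moreover have "(\<lambda>n. 2 * exp 1 * real n powr - (1 / 4) + 2 * (exp (real n powr - 2) - 1)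
      + exp (2 * real n * ln (real n) powr - (5 / 2) - 5 / 2 * (real n / ln (real n) - 1))
      + 64 * ln (real n) ^ 25 * real n powr - 2) \<longlonglongrightarrow> 0"
    by real_asymp
  ultimately show ?thesis
    using tendsto_add by (fastforce simp: add_ac)
qed

text \<open>\<open>K\<^sub>0\<close> is chosen before K and \<alpha>, so how large K must be does
  not depend on \<alpha>. For each fixed K the failure probability has an explicit bound free of
  \<alpha>.\<close>

theorem theorem2p8:
  shows "\<exists>K\<^sub>0 > (0::real). \<forall>K \<ge> K\<^sub>0. \<forall>\<alpha> :: nat \<Rightarrow> real.
    (\<forall>\<^sub>F n in sequentially. 150 \<le> \<alpha> n \<and> \<alpha> n \<le> real n / ln (real n)) \<longrightarrow>
    (\<lambda>n. measure_pmf.prob (gnp n (\<alpha> n * ln (real n) / real n)) {E.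
       graph_connected {1..n} E \<and>
       (\<forall>v\<in>{1..n}.
          \<bar>real (deg E v) - \<alpha> n * ln (real n)\<bar> \<le> 2 * sqrt (\<alpha> n) * ln (real n) \<and>
          5 * \<alpha> n / 6 * ln (real n) \<le> real (deg E v) \<and>
          real (deg E v) \<le> 4 * \<alpha> n / 3 * ln (real n)) \<and>
       (\<forall>S \<subseteq> {1..n}. S \<noteq> {} \<and> real (card S) \<le> 0.8 * real n \<longrightarrow>
          real (card (edge_boundary E S)) >
            real (card S) * real (card ({1..n} - S)) * \<alpha> n * ln (real n) / (2 * real n)) \<and>
       (\<forall>A \<subseteq> {1..n}. A \<noteq> {} \<longrightarrow>
          (real n / (\<alpha> n * ln (real n)) \<le> real (card A) \<and>
             real (card A) \<le> real n / ln (real n) \<longrightarrow>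
           real (card (edges_between E A {u \<in> ext_nbhd {1..n} E A.
               real (card (edges_between E {u} A)) \<ge>
                 K * real (card A) * \<alpha> n * ln (real n) / real n}))
             \<le> real (card A) * \<alpha> n * ln (real n) / K) \<and>
          (real (card A) < real n / (\<alpha> n * ln (real n)) \<longrightarrow>
           real (card (edges_between E A {u \<in> ext_nbhd {1..n} E A.
               real (card (edges_between E {u} A)) \<ge> K}))
             \<le> real (card A) * \<alpha> n * ln (real n) / ln K)) \<and>
       (\<forall>A \<subseteq> {1..n}.
          card A \<in> {nat \<lfloor>real n * ln (ln (real n)) powr 1.5 / ln (real n)\<rfloor>,
                    nat \<lceil>real n * ln (ln (real n)) powr 1.5 / ln (real n)\<rceil>} \<longrightarrow>
          real (card {v \<in> {1..n} - A.
              real (card (edges_between E {v} A)) \<le> \<alpha> n * ln (ln (real n)) powr 1.5 / 2})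
            \<le> real (card A) / 2) \<and>
       (\<alpha> n < (ln (real n))^2 \<longrightarrow>
          (\<forall>v\<in>{1..n}. \<forall>r::nat. real r \<le> ln (real n) / (15 * ln (ln (real n))) \<longrightarrow>
             (\<forall>w \<in> graph_sphere {1..n} E v r.
                card (edges_between E {w} (graph_ball {1..n} E v r)) \<le> 5)))})
    \<longlonglongrightarrow> 1"
\<comment> \<open>The witness is the threshold for ln K \<ge> 4, which the heavy-edge estimate
  needs.\<close>
proof (intro exI[of _ "exp 4"] conjI allI impI)
  show "(0::real) < exp 4" by simp
next
  fix K :: real and \<alpha> :: "nat \<Rightarrow> real"
  assume K: "exp 4 \<le> K"
    and \<alpha>: "\<forall>\<^sub>F n in sequentially. 150 \<le> \<alpha> n \<and> \<alpha> n \<le> real n / ln (real n)"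
  have "0 < K"
    using K by (rule order.strict_trans2[rotated]) simp
  let ?good = "\<lambda>n E. graph_connected {1..n} E \<and> degrees_concentrated n (\<alpha> n) E \<and>
    large_boundaries n (\<alpha> n) E \<and> few_heavy_edges n (\<alpha> n) K E \<and> few_light_vertices n (\<alpha> n) E \<and>
    (\<alpha> n < (ln (real n))\<^sup>2 \<longrightarrow> sparse_balls n E)"
  let ?pr = "\<lambda>n. measure_pmf.prob (gnp n (\<alpha> n * ln (real n) / real n)) {E. ?good n E}"
  let ?b = "\<lambda>n. 2 * exp 1 * real n powr - (1 / 4) + 2 * (exp (real n powr - 2) - 1)
      + exp (real n * real n powr (- (75 / K)) - real n / (2 * K))
      + exp (2 * real n * ln (real n) powr - (5 / 2) - 5 / 2 * (real n / ln (real n) - 1))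
      + 64 * ln (real n) ^ 25 * real n powr - 2"
  \<comment> \<open>The estimates for light vertices and for balls assume this.\<close>
  have "\<forall>\<^sub>F n in sequentially. 1 \<le> ln (ln (real n))"
    by real_asymp
  with \<alpha> eventually_ge_at_top[of 3] have ge: "\<forall>\<^sub>F n in sequentially. 1 - ?b n \<le> ?pr n"
  proof eventually_elim
    case (elim n)
    interpret gnp_regime n "\<alpha> n" "\<alpha> n * ln (real n) / real n"
      by unfold_locales (use elim in auto)
    show ?case
      using K elim by (intro prob_good_ge) auto
  qed
  have "?pr \<longlonglongrightarrow> 1"
  proof (rule tendsto_sandwich[OF ge])
    show "(\<lambda>n. 1 - ?b n) \<longlonglongrightarrow> 1"
      using tendsto_diff[OF tendsto_const failure_bound_tendsto_0[OF \<open>0 < K\<close>], of 1] by simp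
  qed (auto simp: measure_pmf.prob_le_1)
  then show "(\<lambda>n. measure_pmf.prob (gnp n (\<alpha> n * ln (real n) / real n)) {E.
           graph_connected {1..n} E \<and>
           (\<forall>v\<in>{1..n}.
              \<bar>real (deg E v) - \<alpha> n * ln (real n)\<bar> \<le> 2 * sqrt (\<alpha> n) * ln (real n) \<and>
              5 * \<alpha> n / 6 * ln (real n) \<le> real (deg E v) \<and>
              real (deg E v) \<le> 4 * \<alpha> n / 3 * ln (real n)) \<and>
           (\<forall>S \<subseteq> {1..n}. S \<noteq> {} \<and> real (card S) \<le> 0.8 * real n \<longrightarrow>
              real (card (edge_boundary E S)) >
                real (card S) * real (card ({1..n} - S)) * \<alpha> n * ln (real n) / (2 * real n)) \<and>
           (\<forall>A \<subseteq> {1..n}. A \<noteq> {} \<longrightarrow>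
              (real n / (\<alpha> n * ln (real n)) \<le> real (card A) \<and>
                 real (card A) \<le> real n / ln (real n) \<longrightarrow>
               real (card (edges_between E A {u \<in> ext_nbhd {1..n} E A.
                   real (card (edges_between E {u} A)) \<ge>
                     K * real (card A) * \<alpha> n * ln (real n) / real n}))
                 \<le> real (card A) * \<alpha> n * ln (real n) / K) \<and>
              (real (card A) < real n / (\<alpha> n * ln (real n)) \<longrightarrow>
               real (card (edges_between E A {u \<in> ext_nbhd {1..n} E A.
                   real (card (edges_between E {u} A)) \<ge> K}))
                 \<le> real (card A) * \<alpha> n * ln (real n) / ln K)) \<and>
           (\<forall>A \<subseteq> {1..n}.
              card A \<in> {nat \<lfloor>real n * ln (ln (real n)) powr 1.5 / ln (real n)\<rfloor>,
                        nat \<lceil>real n * ln (ln (real n)) powr 1.5 / ln (real n)\<rceil>} \<longrightarrow>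
              real (card {v \<in> {1..n} - A.
                  real (card (edges_between E {v} A)) \<le> \<alpha> n * ln (ln (real n)) powr 1.5 / 2})
                \<le> real (card A) / 2) \<and>
           (\<alpha> n < (ln (real n))^2 \<longrightarrow>
              (\<forall>v\<in>{1..n}. \<forall>r::nat. real r \<le> ln (real n) / (15 * ln (ln (real n))) \<longrightarrow>
                 (\<forall>w \<in> graph_sphere {1..n} E v r.
                    card (edges_between E {w} (graph_ball {1..n} E v r)) \<le> 5)))})
        \<longlonglongrightarrow> 1"
    unfolding degrees_concentrated_def large_boundaries_def few_heavy_edges_def heavy_neighbours_def
      few_light_vertices_def sparse_balls_def .
qed

end
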